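(* Let $N=\mathbb{Q}^n$ be a rational affine space, let $\Delta\subseteq N$ be a non-empty, bounded, rational polytope, let $Q$ be the additive group of affine functions on $N$ with integer slopes (and real constant term), and let $Q^+\subseteq Q$ be the submonoid of functions that are $\leq 0$ at every point of $\Delta$. Then the evaluation map $$\mathrm{ev}:\mathbb{B}[Q;Q^+]\longrightarrow \mathrm{CPA}_{\mathbb{Z}}(\Delta,\mathbb{R})$$ is a normalisation of idempotent semirings.
   Context: An idempotent semiring $(\alpha,\vee,-\infty,+,0)$ is a commutative semiring written in max-plus notation: $\vee$ is the commutative idempotent semiring "sum" with neutral element $-\infty$; $+$ is the commutative semiring "product" with unit $0$; $+$ distributes over $\vee$ and $-\infty$ is absorbing for $+$. It is ordered by $X\leq Y$ iff $X\vee Y=Y$. An element is invertible if it has an inverse for $+$, and bounded if it lies between two invertible elements. All semirings are assumed to satisfy the Tate condition: every element is bounded above by an invertible element. An $\alpha$-module is an idempotent commutative monoid $(\mu,\vee,-\infty)$ with an action $+$ of $\alpha$ compatible with $\vee$ and $-\infty$ in both variables. An $\alpha$-module $\mu$ is normal if bounded elements $S\in\alpha$ act cancellatively on it: $X+S=Y+S$ implies $X=Y$ for $X,Y\in\mu$. A semiring is normal if it is normal as a module over itself. A normalisation of $\mu$ is an initial homomorphism from $\mu$ to a normal $\alpha$-module. A semiring homomorphism $f:\alpha\to\beta$ is a normalisation if it is a normalisation of $\alpha$ as an $\alpha$-module; equivalently, $f$ is surjective and $f(X)=f(Y)$ if and only if there is a bounded $S\in\alpha$ with $X+S=Y+S$.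 Setting. $Q$ consists of the functions $x\mapsto k\cdot x+c$ on $\mathbb{Q}^n$ with $k\in\mathbb{Z}^n$, $c\in\mathbb{R}$. A rational polytope is a subset of $\mathbb{Q}^n$ cut out by finitely many inequalities $F_i\leq\lambda_i$ with $F_i$ affine with integer slopes and rational constant term, and $\lambda_i\in\mathbb{Q}$. $\mathbb{B}[Q;Q^+]$ is the set of fractional ideals of $(Q;Q^+)$, i.e. finitely generated $Q^+$-invariant subsets $I=\bigcup_{j=1}^m (G_j+Q^+)\subseteq Q$ (including the empty set), which is an idempotent semiring with $I\vee J=I\cup J$, $-\infty=\emptyset$, $I+J=\{a+b: a\in I,b\in J\}$ and unit $Q^+$. $\mathrm{CPA}_{\mathbb{Z}}(\Delta,\mathbb{R})$ is the semiring of convex piecewise-affine functions on $\Delta$ with integer slopes, i.e. of functions $\Delta\to\mathbb{R}$ that are pointwise maxima of finitely many (at least one) restrictions to $\Delta$ of elements of $Q$, together with an element $-\infty$; the operations are pointwise maximum and pointwise addition. The evaluation map sends $\bigcup_{j}(G_j+Q^+)$ to the function $\max_j G_j|_\Delta$, and $\emptyset$ to $-\infty$. *)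

theory Defs
  imports Complex_Main "HOL-Algebra.Module" "HOL-Algebra.Coset" "HOL-Library.FuncSet"
begin

section \<open>Idempotent semirings, modules and normalisation\<close>

text \<open>
  Max-plus dictionary for the fields of the ring and module records:
  \<open>\<oplus>\<close> is the join, \<open>\<zero>\<close> is minus infinity, \<open>\<otimes>\<close> is the max-plus sum, \<open>\<one>\<close> is the max-plus
  zero, \<open>\<odot>\<close> is the action of a semiring on a module.
\<close>

definition idem_le :: "('a, 'm) ring_scheme \<Rightarrow> 'a \<Rightarrow> 'a \<Rightarrow> bool" where
  "idem_le R x y \<longleftrightarrow> x \<oplus>\<^bsub>R\<^esub> y = y"

locale idem_semiring = semiring R + comm_monoid R for R (structure) +
  assumes add_idem: "x \<in> carrier R \<Longrightarrow> x \<oplus> x = x"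
    and tate: "x \<in> carrier R \<Longrightarrow> \<exists>u \<in> Units R. idem_le R x u"

definition bounded_elements :: "('a, 'm) ring_scheme \<Rightarrow> 'a set" where
  "bounded_elements R =
     {s \<in> carrier R. \<exists>u \<in> Units R. \<exists>v \<in> Units R. idem_le R u s \<and> idem_le R s v}"

text \<open>The multiplicative fields of the module record play no role.\<close>

locale idem_module = R?: idem_semiring R + M?: abelian_monoid M
  for R (structure) and M :: "('a, 'b, 'c) module_scheme" (structure) +
  assumes madd_idem: "x \<in> carrier M \<Longrightarrow> x \<oplus>\<^bsub>M\<^esub> x = x"
    and smult_closed: "\<lbrakk>a \<in> carrier R; x \<in> carrier M\<rbrakk> \<Longrightarrow> a \<odot>\<^bsub>M\<^esub> x \<in> carrier M"
    and smult_one: "x \<in> carrier M \<Longrightarrow> \<one>\<^bsub>R\<^esub> \<odot>\<^bsub>M\<^esub> x = x"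
    and smult_assoc: "\<lbrakk>a \<in> carrier R; b \<in> carrier R; x \<in> carrier M\<rbrakk> \<Longrightarrow>
           (a \<otimes>\<^bsub>R\<^esub> b) \<odot>\<^bsub>M\<^esub> x = a \<odot>\<^bsub>M\<^esub> (b \<odot>\<^bsub>M\<^esub> x)"
    and smult_l_distr: "\<lbrakk>a \<in> carrier R; b \<in> carrier R; x \<in> carrier M\<rbrakk> \<Longrightarrow>
           (a \<oplus>\<^bsub>R\<^esub> b) \<odot>\<^bsub>M\<^esub> x = a \<odot>\<^bsub>M\<^esub> x \<oplus>\<^bsub>M\<^esub> b \<odot>\<^bsub>M\<^esub> x"
    and smult_r_distr: "\<lbrakk>a \<in> carrier R; x \<in> carrier M; y \<in> carrier M\<rbrakk> \<Longrightarrow>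
           a \<odot>\<^bsub>M\<^esub> (x \<oplus>\<^bsub>M\<^esub> y) = a \<odot>\<^bsub>M\<^esub> x \<oplus>\<^bsub>M\<^esub> a \<odot>\<^bsub>M\<^esub> y"
    and smult_l_null: "x \<in> carrier M \<Longrightarrow> \<zero>\<^bsub>R\<^esub> \<odot>\<^bsub>M\<^esub> x = \<zero>\<^bsub>M\<^esub>"
    and smult_r_null: "a \<in> carrier R \<Longrightarrow> a \<odot>\<^bsub>M\<^esub> \<zero>\<^bsub>M\<^esub> = \<zero>\<^bsub>M\<^esub>"

locale normal_module = idem_module +
  assumes smult_cancel:
    "\<lbrakk>s \<in> bounded_elements R; x \<in> carrier M; y \<in> carrier M; s \<odot>\<^bsub>M\<^esub> x = s \<odot>\<^bsub>M\<^esub> y\<rbrakk> \<Longrightarrow> x = y"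

definition idem_module_hom ::
  "('a, 'm) ring_scheme \<Rightarrow> ('a, 'b, 'k) module_scheme \<Rightarrow> ('a, 'c, 'l) module_scheme \<Rightarrow> ('b \<Rightarrow> 'c) set" where
  "idem_module_hom R M N =
     {h \<in> carrier M \<rightarrow> carrier N.
        h \<zero>\<^bsub>M\<^esub> = \<zero>\<^bsub>N\<^esub> \<and>
        (\<forall>x \<in> carrier M. \<forall>y \<in> carrier M. h (x \<oplus>\<^bsub>M\<^esub> y) = h x \<oplus>\<^bsub>N\<^esub> h y) \<and>
        (\<forall>a \<in> carrier R. \<forall>x \<in> carrier M. h (a \<odot>\<^bsub>M\<^esub> x) = a \<odot>\<^bsub>N\<^esub> h x)}"

text \<open>
  A normalisation is an initial homomorphism to a normal module. The type argument is the type
  carrying the test modules \<open>P\<close>; a statement in which it is a free type variable quantifies over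
  all normal modules. Extensionality makes uniqueness refer to the values on the carrier only.
\<close>

definition module_normalisation ::
  "'c itself \<Rightarrow> ('a, 'm) ring_scheme \<Rightarrow> ('a, 'b) module \<Rightarrow> ('a, 'd) module \<Rightarrow> ('b \<Rightarrow> 'd) \<Rightarrow> bool" where
  "module_normalisation (_ :: 'c itself) R M N f \<longleftrightarrow>
     idem_module R M \<and> normal_module R N \<and> f \<in> idem_module_hom R M N \<and>
     (\<forall>(P :: ('a, 'c) module) g.
        normal_module R P \<and> g \<in> idem_module_hom R M P \<longrightarrow>
        (\<exists>!h. h \<in> idem_module_hom R N P \<inter> extensional (carrier N) \<and>
              (\<forall>x \<in> carrier M. h (f x) = g x)))"

definition restrict_scalars :: "('a \<Rightarrow> 'b) \<Rightarrow> ('b, 'm) ring_scheme \<Rightarrow> ('a, 'b) module" where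
  "restrict_scalars f S =
     \<lparr>carrier = carrier S, mult = mult S, one = one S, zero = zero S, add = add S,
      smult = (\<lambda>a y. f a \<otimes>\<^bsub>S\<^esub> y)\<rparr>"

text \<open>\<open>ring_hom\<close> alone does not include preservation of \<open>\<zero>\<close>.\<close>

definition idem_semiring_hom ::
  "('a, 'm) ring_scheme \<Rightarrow> ('b, 'n) ring_scheme \<Rightarrow> ('a \<Rightarrow> 'b) set" where
  "idem_semiring_hom R S = {f \<in> ring_hom R S. f \<zero>\<^bsub>R\<^esub> = \<zero>\<^bsub>S\<^esub>}"

text \<open>\<open>restrict_scalars (\<lambda>a. a) R\<close> is \<open>R\<close> as a module over itself.\<close>

definition semiring_normalisation ::
  "'c itself \<Rightarrow> ('a, 'm) ring_scheme \<Rightarrow> ('b, 'n) ring_scheme \<Rightarrow> ('a \<Rightarrow> 'b) \<Rightarrow> bool" where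
  "semiring_normalisation (T :: 'c itself) R S f \<longleftrightarrow>
     idem_semiring R \<and> idem_semiring S \<and> f \<in> idem_semiring_hom R S \<and>
     module_normalisation T R (restrict_scalars (\<lambda>a. a) R) (restrict_scalars f S) f"

section \<open>Fractional ideals\<close>

definition ideal_gen :: "('a, 'm) monoid_scheme \<Rightarrow> 'a set \<Rightarrow> 'a set \<Rightarrow> 'a set" where
  "ideal_gen Q Qp G = (\<Union>g \<in> G. g <#\<^bsub>Q\<^esub> Qp)"

definition frac_ideals :: "('a, 'm) monoid_scheme \<Rightarrow> 'a set \<Rightarrow> 'a set ring" where
  "frac_ideals Q Qp =
     \<lparr>carrier = {ideal_gen Q Qp G | G. finite G \<and> G \<subseteq> carrier Q},
      mult = (\<lambda>I J. I <#>\<^bsub>Q\<^esub> J), one = Qp, zero = {}, add = (\<union>)\<rparr>"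

section \<open>Affine functions, polytopes and convex piecewise-affine functions\<close>

type_synonym point = "nat \<Rightarrow> rat"

definition rat_space :: "nat \<Rightarrow> point set" where
  "rat_space n = {..<n} \<rightarrow>\<^sub>E UNIV"

definition affine_fun :: "nat \<Rightarrow> (nat \<Rightarrow> int) \<Rightarrow> real \<Rightarrow> point \<Rightarrow> real" where
  "affine_fun n k c = (\<lambda>x \<in> rat_space n. (\<Sum>i<n. of_int (k i) * of_rat (x i)) + c)"

text \<open>The additive group \<open>Q\<close>, with its pointwise addition in the \<open>mult\<close> field of the record.\<close>

definition affine_group :: "nat \<Rightarrow> (point \<Rightarrow> real) monoid" where
  "affine_group n =
     \<lparr>carrier = {affine_fun n k c | k c. True},
      mult = (\<lambda>f g. \<lambda>x \<in> rat_space n. f x + g x),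
      one = (\<lambda>x \<in> rat_space n. 0)\<rparr>"

definition nonpos_on :: "nat \<Rightarrow> point set \<Rightarrow> (point \<Rightarrow> real) set" where
  "nonpos_on n \<Delta> = {f \<in> carrier (affine_group n). \<forall>x \<in> \<Delta>. f x \<le> 0}"

text \<open>Each triple \<open>(k, c, l)\<close> stands for the inequality \<open>k \<bullet> x + c \<le> l\<close>.\<close>

definition rational_polytope :: "nat \<Rightarrow> point set \<Rightarrow> bool" where
  "rational_polytope n \<Delta> \<longleftrightarrow>
     (\<exists>A :: ((nat \<Rightarrow> int) \<times> rat \<times> rat) set. finite A \<and>
        \<Delta> = {x \<in> rat_space n. \<forall>(k, c, l) \<in> A. (\<Sum>i<n. of_int (k i) * x i) + c \<le> l})"

definition bounded_points :: "nat \<Rightarrow> point set \<Rightarrow> bool" where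
  "bounded_points n \<Delta> \<longleftrightarrow> (\<exists>b. \<forall>x \<in> \<Delta>. \<forall>i<n. \<bar>x i\<bar> \<le> b)"

definition max_on :: "point set \<Rightarrow> (point \<Rightarrow> real) set \<Rightarrow> point \<Rightarrow> real" where
  "max_on \<Delta> G = (\<lambda>x \<in> \<Delta>. Max ((\<lambda>g. g x) ` G))"

text \<open>\<open>None\<close> is the element minus infinity.\<close>

definition CPA :: "nat \<Rightarrow> point set \<Rightarrow> (point \<Rightarrow> real) option ring" where
  "CPA n \<Delta> =
     \<lparr>carrier = insert None
        {Some (max_on \<Delta> G) | G. finite G \<and> G \<noteq> {} \<and> G \<subseteq> carrier (affine_group n)},
      mult = (\<lambda>a b. case (a, b) of
                (Some f, Some g) \<Rightarrow> Some (\<lambda>x \<in> \<Delta>. f x + g x) | _ \<Rightarrow> None),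
      one = Some (\<lambda>x \<in> \<Delta>. 0),
      zero = None,
      add = (\<lambda>a b. case (a, b) of
                (Some f, Some g) \<Rightarrow> Some (\<lambda>x \<in> \<Delta>. max (f x) (g x))
              | (None, _) \<Rightarrow> b | (_, None) \<Rightarrow> a)\<rparr>"

text \<open>Independence of the choice of generators is lemma \<open>ev_ideal_gen\<close>.\<close>

definition ev :: "nat \<Rightarrow> point set \<Rightarrow> (point \<Rightarrow> real) set \<Rightarrow> (point \<Rightarrow> real) option" where
  "ev n \<Delta> I = (THE y. \<exists>G. finite G \<and> G \<subseteq> carrier (affine_group n) \<and>
                  I = ideal_gen (affine_group n) (nonpos_on n \<Delta>) G \<and>
                  y = (if G = {} then None else Some (max_on \<Delta> G)))"

lemma zero_in_nonpos_on: "(\<lambda>x \<in> rat_space n. 0) \<in> nonpos_on n \<Delta>" if "\<Delta> \<subseteq> rat_space n"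
proof -
  have "(\<lambda>x \<in> rat_space n. 0) = affine_fun n (\<lambda>_. 0) 0"
    by (auto simp: affine_fun_def)
  then have "(\<lambda>x \<in> rat_space n. 0) \<in> carrier (affine_group n)"
    unfolding affine_group_def by auto
  then show ?thesis
    using that by (auto simp: nonpos_on_def)
qed

lemma gen_in_ideal_gen:
  assumes "\<Delta> \<subseteq> rat_space n" "G \<subseteq> carrier (affine_group n)" "g \<in> G"
  shows "g \<in> ideal_gen (affine_group n) (nonpos_on n \<Delta>) G"
proof -
  have "g = g \<otimes>\<^bsub>affine_group n\<^esub> (\<lambda>x \<in> rat_space n. 0)"
    using assms(2,3) by (fastforce simp: affine_group_def affine_fun_def fun_eq_iff)
  then show ?thesis
    using zero_in_nonpos_on[OF assms(1)] assms(3) unfolding ideal_gen_def l_coset_def by blast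
qed

lemma max_on_mono:
  assumes D: "\<Delta> \<subseteq> rat_space n" and G: "G \<subseteq> carrier (affine_group n)" "finite G" "G \<noteq> {}"
    and H: "finite H"
    and sub: "ideal_gen (affine_group n) (nonpos_on n \<Delta>) G
                \<subseteq> ideal_gen (affine_group n) (nonpos_on n \<Delta>) H"
    and x: "x \<in> \<Delta>"
  shows "max_on \<Delta> G x \<le> max_on \<Delta> H x"
proof -
  have "g x \<le> Max ((\<lambda>g. g x) ` H)" if "g \<in> G" for g
  proof -
    have "g \<in> ideal_gen (affine_group n) (nonpos_on n \<Delta>) H"
      using gen_in_ideal_gen[OF D G(1) that] sub by blast
    then obtain h p where hp: "h \<in> H" "p \<in> nonpos_on n \<Delta>" "g = (\<lambda>x \<in> rat_space n. h x + p x)"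
      by (auto simp: ideal_gen_def l_coset_def affine_group_def)
    then have "g x \<le> h x"
      using x D by (auto simp: nonpos_on_def)
    also have "h x \<le> Max ((\<lambda>g. g x) ` H)"
      using hp(1) H by simp
    finally show ?thesis .
  qed
  then show ?thesis
    using G x by (simp add: max_on_def)
qed

lemma ev_ideal_gen:
  assumes D: "\<Delta> \<subseteq> rat_space n" and G: "finite G" "G \<subseteq> carrier (affine_group n)"
  shows "ev n \<Delta> (ideal_gen (affine_group n) (nonpos_on n \<Delta>) G) =
           (if G = {} then None else Some (max_on \<Delta> G))"
  unfolding ev_def
proof (rule the_equality)
  fix y
  assume "\<exists>H. finite H \<and> H \<subseteq> carrier (affine_group n) \<and>
      ideal_gen (affine_group n) (nonpos_on n \<Delta>) G = ideal_gen (affine_group n) (nonpos_on n \<Delta>) H \<and>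
      y = (if H = {} then None else Some (max_on \<Delta> H))"
  then obtain H where H: "finite H" "H \<subseteq> carrier (affine_group n)"
    and eq: "ideal_gen (affine_group n) (nonpos_on n \<Delta>) G = ideal_gen (affine_group n) (nonpos_on n \<Delta>) H"
    and y: "y = (if H = {} then None else Some (max_on \<Delta> H))"
    by blast
  have empty: "G = {} \<longleftrightarrow> H = {}"
    using gen_in_ideal_gen[OF D G(2)] gen_in_ideal_gen[OF D H(2)] eq
    by (fastforce simp: ideal_gen_def)
  moreover have "max_on \<Delta> G = max_on \<Delta> H" if "G \<noteq> {}"
  proof
    fix x
    show "max_on \<Delta> G x = max_on \<Delta> H x"
    proof (cases "x \<in> \<Delta>")
      case True
      show ?thesis
        using max_on_mono[OF D G(2,1) that H(1) _ True] max_on_mono[OF D H(2,1) _ G(1) _ True]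
          eq that empty by fastforce
    qed (simp add: max_on_def)
  qed
  ultimately show "y = (if G = {} then None else Some (max_on \<Delta> G))"
    using y by simp
qed (use G in blast)

end

theory Submission
  imports Defs
begin

text \<open>
  A surjective homomorphism is a normalisation as soon as it identifies exactly the elements that
  become equal after multiplication by a bounded element. Pointwise sums of real functions cancel,
  so the point is to show that an affine \<open>g\<close> with \<open>g \<le> max G\<close> on \<open>\<Delta>\<close> can be added to the
  generators \<open>G\<close> after such a multiplication. The inequalities of \<open>\<Delta>\<close> together with \<open>h < g\<close> for
  \<open>h \<in> G\<close> have no rational solution. Slopes are integers and the weak inequalities have rational
  constants, so Fourier--Motzkin elimination works over \<open>\<rat>\<close>, although the strict inequalities have
  real constants, and it yields \<open>h\<^sub>1, \<dots>, h\<^sub>N \<in> G\<close> with \<open>N g \<le> h\<^sub>1 + \<dots> + h\<^sub>N\<close> on \<open>\<Delta>\<close>.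
  This is an equation of integral dependence of \<open>g\<close> on the ideal \<open>J\<close> generated by \<open>G\<close>, and the
  \<open>(N - 1)\<close>-fold power of \<open>g \<or> J\<close> is the required bounded element.
\<close>

section \<open>Stable equality in idempotent semirings\<close>

context idem_semiring
begin

lemma join_left_idem:
  assumes "x \<in> carrier R" "y \<in> carrier R"
  shows "x \<oplus> (x \<oplus> y) = x \<oplus> y"
  using assms by (simp add: add_idem flip: a_assoc)

lemma le_refl: "x \<in> carrier R \<Longrightarrow> idem_le R x x"
  by (simp add: idem_le_def add_idem)

text \<open>Expanding \<open>(a \<oplus> b) \<otimes> (c \<oplus> d)\<close> exhibits
  \<open>a \<otimes> c\<close> as a joinand of \<open>b \<otimes> d\<close>, and idempotency absorbs
  it.\<close>

lemma le_mult_mono: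
  assumes "idem_le R a b" "idem_le R c d"
    and "a \<in> carrier R" "b \<in> carrier R" "c \<in> carrier R" "d \<in> carrier R"
  shows "idem_le R (a \<otimes> c) (b \<otimes> d)"
proof -
  have "b \<otimes> d = (a \<oplus> b) \<otimes> (c \<oplus> d)"
    using assms by (simp add: idem_le_def)
  also have "\<dots> = a \<otimes> c \<oplus> (a \<otimes> d \<oplus> (b \<otimes> c \<oplus> b \<otimes> d))"
    using assms(3-) by (simp add: l_distr r_distr a_ac)
  finally have eq: "b \<otimes> d = a \<otimes> c \<oplus> (a \<otimes> d \<oplus> (b \<otimes> c \<oplus> b \<otimes> d))" .
  have "a \<otimes> c \<oplus> b \<otimes> d = b \<otimes> d"
    by (subst (1 2) eq) (use assms(3-) in \<open>simp add: join_left_idem\<close>)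
  then show ?thesis
    by (simp add: idem_le_def)
qed

lemma bounded_mult:
  assumes "s \<in> bounded_elements R" "t \<in> bounded_elements R"
  shows "s \<otimes> t \<in> bounded_elements R"
proof -
  obtain u v u' v' where *: "u \<in> Units R" "v \<in> Units R" "u' \<in> Units R" "v' \<in> Units R"
      "idem_le R u s" "idem_le R s v" "idem_le R u' t" "idem_le R t v'"
    and c: "s \<in> carrier R" "t \<in> carrier R"
    using assms unfolding bounded_elements_def by blast
  have "idem_le R (u \<otimes> u') (s \<otimes> t)" "idem_le R (s \<otimes> t) (v \<otimes> v')"
    using le_mult_mono * c by (simp_all add: Units_closed)
  moreover have "u \<otimes> u' \<in> Units R" "v \<otimes> v' \<in> Units R"
    using * by simp_all
  ultimately show ?thesis
    using c unfolding bounded_elements_def by blast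
qed

lemma bounded_carrier: "s \<in> bounded_elements R \<Longrightarrow> s \<in> carrier R"
  by (simp add: bounded_elements_def)

text \<open>These are pairs that every module homomorphism from the semiring to a normal module has
  to identify.\<close>

definition stably_eq :: "'a \<Rightarrow> 'a \<Rightarrow> bool" where
  "stably_eq x y \<longleftrightarrow> (\<exists>s \<in> bounded_elements R. s \<otimes> x = s \<otimes> y)"

lemma stably_eq_sym: "stably_eq x y \<Longrightarrow> stably_eq y x"
  unfolding stably_eq_def by metis

text \<open>The product of the two witnesses is a witness for the composite, since commutativity
  lets either factor act first.\<close>

lemma stably_eq_trans:
  assumes "stably_eq x y" "stably_eq y z" "x \<in> carrier R" "y \<in> carrier R" "z \<in> carrier R"
  shows "stably_eq x z"
proof -
  obtain s t where st: "s \<in> bounded_elements R" "t \<in> bounded_elements R"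
    "s \<otimes> x = s \<otimes> y" "t \<otimes> y = t \<otimes> z"
    using assms unfolding stably_eq_def by blast
  note c = st(1,2)[THEN bounded_carrier]
  have "(s \<otimes> t) \<otimes> x = t \<otimes> (s \<otimes> x)"
    using c assms(3-) by (simp add: m_ac)
  also have "\<dots> = s \<otimes> (t \<otimes> y)"
    using c assms(3-) st by (simp add: m_ac)
  also have "\<dots> = (s \<otimes> t) \<otimes> z"
    using c assms(3-) st by (simp add: m_ac)
  finally show ?thesis
    using bounded_mult st(1,2) unfolding stably_eq_def by blast
qed

lemma stably_eq_add:
  assumes "stably_eq x y" "x \<in> carrier R" "y \<in> carrier R" "z \<in> carrier R"
  shows "stably_eq (z \<oplus> x) (z \<oplus> y)"
  using assms bounded_carrier unfolding stably_eq_def by (metis r_distr)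

text \<open>Every monomial in the expansion other than \<open>u [^] Suc m\<close> has a factor
  \<open>j\<close>, and its other \<open>m\<close> factors lie below \<open>u \<oplus> j\<close>.
  The induction avoids writing out the expansion.\<close>

lemma join_pow_le:
  assumes "u \<in> carrier R" "j \<in> carrier R"
  shows "idem_le R ((u \<oplus> j) [^] Suc m) (u [^] Suc m \<oplus> (u \<oplus> j) [^] m \<otimes> j)"
proof (induction m)
  case 0
  then show ?case
    using assms by (simp add: idem_le_def add_idem)
next
  case (Suc m)
  define w a p where "w = u \<oplus> j" and "a = u [^] Suc m" and "p = w [^] m"
  have c: "w \<in> carrier R" "a \<in> carrier R" "p \<in> carrier R"
    unfolding w_def a_def p_def using assms by auto
  have "idem_le R (p \<otimes> w) (a \<oplus> p \<otimes> j)"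
    using Suc unfolding p_def a_def w_def by simp
  then have "idem_le R (p \<otimes> w \<otimes> u) ((a \<oplus> p \<otimes> j) \<otimes> u)"
    using c assms by (simp add: le_mult_mono le_refl)
  then have IH: "p \<otimes> w \<otimes> u \<oplus> (a \<otimes> u \<oplus> p \<otimes> j \<otimes> u) = a \<otimes> u \<oplus> p \<otimes> j \<otimes> u"
    using c assms by (simp add: idem_le_def l_distr)
  have pwj: "p \<otimes> w \<otimes> j = p \<otimes> u \<otimes> j \<oplus> p \<otimes> j \<otimes> j"
    using c assms by (simp add: w_def l_distr r_distr)
  have pju: "p \<otimes> j \<otimes> u = p \<otimes> u \<otimes> j"
    using c assms by (simp add: m_ac)
  \<comment> \<open>The induction hypothesis multiplied by \<open>u\<close> leaves the remainder
    \<open>p \<otimes> j \<otimes> u\<close>, which disappears in the part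
    \<open>p \<otimes> w \<otimes> j\<close> of \<open>p \<otimes> w \<otimes> w\<close>.\<close>
  have absorb: "p \<otimes> j \<otimes> u \<oplus> p \<otimes> w \<otimes> j = p \<otimes> w \<otimes> j"
    using c assms by (simp add: pwj pju join_left_idem)
  have pww: "p \<otimes> w \<otimes> w = p \<otimes> w \<otimes> u \<oplus> p \<otimes> w \<otimes> j"
    using c assms by (simp add: w_def r_distr)
  have "p \<otimes> w \<otimes> w \<oplus> (a \<otimes> u \<oplus> p \<otimes> w \<otimes> j)
      = (p \<otimes> w \<otimes> u \<oplus> (a \<otimes> u \<oplus> p \<otimes> j \<otimes> u)) \<oplus> p \<otimes> w \<otimes> j"
    unfolding pww using c assms absorb
    by (simp add: a_assoc) (simp add: a_ac join_left_idem add_idem)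
  also have "\<dots> = a \<otimes> u \<oplus> p \<otimes> w \<otimes> j"
    unfolding IH using c assms absorb by (simp add: a_assoc)
  finally show ?case
    unfolding idem_le_def using p_def a_def w_def by simp
qed

text \<open>Integral dependence of \<open>u\<close> on \<open>j\<close>: a power of \<open>u \<oplus> j\<close> absorbs \<open>u\<close> into \<open>j\<close>.\<close>

lemma stably_eq_of_pow_le:
  assumes c: "u \<in> carrier R" "j \<in> carrier R"
    and bdd: "u \<oplus> j \<in> bounded_elements R" "\<one> \<in> bounded_elements R"
    and le: "idem_le R (u [^] Suc m) (j [^] Suc m)"
  shows "stably_eq (u \<oplus> j) j"
proof -
  define w where "w = u \<oplus> j"
  have w: "w \<in> carrier R"
    using c w_def by simp
  \<comment> \<open>The witness is going to be \<open>w [^] m\<close>, which is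
    \<open>\<one>\<close> when \<open>m = 0\<close>.\<close>
  have pow_bdd: "w [^] k \<in> bounded_elements R" for k :: nat
    by (induction k) (use bdd bounded_mult w_def in auto)
  have jw: "idem_le R j w"
    using c w_def by (simp add: idem_le_def a_ac join_left_idem add_idem)
  have "idem_le R (j [^] k) (w [^] k)" for k :: nat
    by (induction k) (use c w jw in \<open>simp_all add: le_mult_mono le_refl\<close>)
  then have jm: "idem_le R (j [^] Suc m) (w [^] m \<otimes> j)"
    using c w by (simp add: le_mult_mono le_refl)
  \<comment> \<open>The chain is \<open>u [^] Suc m\<close> below \<open>j [^] Suc m\<close> below
    \<open>w [^] m \<otimes> j\<close>; it removes the pure power of \<open>u\<close> from the bound
    in \<open>join_pow_le\<close>.\<close>
  have um: "u [^] Suc m \<oplus> w [^] m \<otimes> j = w [^] m \<otimes> j"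
  proof -
    have "u [^] Suc m \<oplus> w [^] m \<otimes> j = u [^] Suc m \<oplus> (j [^] Suc m \<oplus> w [^] m \<otimes> j)"
      using jm unfolding idem_le_def by simp
    also have "\<dots> = j [^] Suc m \<oplus> w [^] m \<otimes> j"
      using le c w unfolding idem_le_def by (simp flip: a_assoc)
    finally show ?thesis
      using jm unfolding idem_le_def by simp
  qed
  have "idem_le R (w [^] m \<otimes> w) (w [^] m \<otimes> j)"
    using join_pow_le[OF c, of m] um unfolding w_def by simp
  moreover have "idem_le R (w [^] m \<otimes> j) (w [^] m \<otimes> w)"
    using jw c w by (simp add: le_mult_mono le_refl)
  ultimately have "w [^] m \<otimes> w = w [^] m \<otimes> j"
    using c w by (simp add: idem_le_def a_comm)
  then show ?thesis
    using pow_bdd unfolding stably_eq_def w_def by blast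
qed

end

section \<open>A criterion for normalisations\<close>

text \<open>Closure conditions and identities pass to a surjective image, and the Tate condition
  passes because units go to units. This spares a direct verification of the axioms for
  \<open>CPA\<close>.\<close>

lemma idem_semiring_surj_image:
  assumes R: "idem_semiring R" and f: "f \<in> idem_semiring_hom R S" and surj: "f ` carrier R = carrier S"
  shows "idem_semiring S"
proof -
  interpret R: idem_semiring R by (rule R)
  have hom: "\<And>x y. x \<in> carrier R \<Longrightarrow> y \<in> carrier R \<Longrightarrow> f x \<oplus>\<^bsub>S\<^esub> f y = f (x \<oplus>\<^bsub>R\<^esub> y)"
      "\<And>x y. x \<in> carrier R \<Longrightarrow> y \<in> carrier R \<Longrightarrow> f x \<otimes>\<^bsub>S\<^esub> f y = f (x \<otimes>\<^bsub>R\<^esub> y)"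
      "\<one>\<^bsub>S\<^esub> = f \<one>\<^bsub>R\<^esub>" "\<zero>\<^bsub>S\<^esub> = f \<zero>\<^bsub>R\<^esub>"
    using f by (auto simp: idem_semiring_hom_def ring_hom_def)
  have units: "f u \<in> Units S" if unit: "u \<in> Units R" for u
  proof -
    obtain v where v: "v \<in> carrier R" "u \<otimes>\<^bsub>R\<^esub> v = \<one>\<^bsub>R\<^esub>" "v \<otimes>\<^bsub>R\<^esub> u = \<one>\<^bsub>R\<^esub>"
      using unit unfolding Units_def by blast
    have u: "u \<in> carrier R"
      using unit by (rule R.Units_closed)
    have "f u \<in> carrier S" "f v \<in> carrier S"
      using imageI[OF u, of f] imageI[OF v(1), of f] by (simp_all only: surj)
    moreover have "f u \<otimes>\<^bsub>S\<^esub> f v = \<one>\<^bsub>S\<^esub>" "f v \<otimes>\<^bsub>S\<^esub> f u = \<one>\<^bsub>S\<^esub>"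
      using u v by (simp_all add: hom)
    ultimately show ?thesis
      unfolding Units_def by blast
  qed
  have tate: "\<exists>u \<in> Units S. idem_le S (f x) u" if x: "x \<in> carrier R" for x
  proof -
    obtain u where "u \<in> Units R" "idem_le R x u"
      using R.tate x by blast
    then have "idem_le S (f x) (f u)"
      using x R.Units_closed by (auto simp: idem_le_def hom)
    then show ?thesis
      using units \<open>u \<in> Units R\<close> by blast
  qed
  show ?thesis
    by (unfold_locales; use surj[symmetric] in \<open>auto simp: hom R.a_ac R.m_ac R.l_distr R.r_distr R.add_idem tate\<close>)
qed

lemma idem_module_restrict_scalars:
  assumes R: "idem_semiring R" and S: "idem_semiring S" and f: "f \<in> idem_semiring_hom R S"
  shows "idem_module R (restrict_scalars f S)"
proof -
  interpret R: idem_semiring R by (rule R)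
  interpret S: idem_semiring S by (rule S)
  have hom: "\<And>x y. x \<in> carrier R \<Longrightarrow> y \<in> carrier R \<Longrightarrow> f (x \<oplus>\<^bsub>R\<^esub> y) = f x \<oplus>\<^bsub>S\<^esub> f y"
      "\<And>x y. x \<in> carrier R \<Longrightarrow> y \<in> carrier R \<Longrightarrow> f (x \<otimes>\<^bsub>R\<^esub> y) = f x \<otimes>\<^bsub>S\<^esub> f y"
      "f \<one>\<^bsub>R\<^esub> = \<one>\<^bsub>S\<^esub>" "f \<zero>\<^bsub>R\<^esub> = \<zero>\<^bsub>S\<^esub>" "\<And>x. x \<in> carrier R \<Longrightarrow> f x \<in> carrier S"
    using f by (auto simp: idem_semiring_hom_def ring_hom_def)
  show ?thesis
    by unfold_locales
      (auto simp: restrict_scalars_def hom S.a_ac S.m_assoc S.l_distr S.r_distr S.add_idem)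
qed

text \<open>Elements with the same image are stably equal, so a homomorphism to a normal module is
  constant on the fibres of \<open>f\<close> and factors through \<open>f\<close>; surjectivity
  makes the factor unique.\<close>

lemma semiring_normalisationI:
  assumes R: "idem_semiring R" and f: "f \<in> idem_semiring_hom R S" and surj: "f ` carrier R = carrier S"
    and ker: "\<And>x y. x \<in> carrier R \<Longrightarrow> y \<in> carrier R \<Longrightarrow>
                f x = f y \<longleftrightarrow> idem_semiring.stably_eq R x y"
  shows "semiring_normalisation TYPE('c) R S f"
proof -
  have S: "idem_semiring S"
    using idem_semiring_surj_image[OF R f surj] .
  interpret R: idem_semiring R by (rule R)
  interpret S: idem_semiring S by (rule S)
  let ?M = "restrict_scalars (\<lambda>a. a) R" and ?N = "restrict_scalars f S"
  have hom: "\<And>x y. x \<in> carrier R \<Longrightarrow> y \<in> carrier R \<Longrightarrow> f (x \<oplus>\<^bsub>R\<^esub> y) = f x \<oplus>\<^bsub>S\<^esub> f y"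
      "\<And>x y. x \<in> carrier R \<Longrightarrow> y \<in> carrier R \<Longrightarrow> f (x \<otimes>\<^bsub>R\<^esub> y) = f x \<otimes>\<^bsub>S\<^esub> f y"
      "f \<zero>\<^bsub>R\<^esub> = \<zero>\<^bsub>S\<^esub>" "\<And>x. x \<in> carrier R \<Longrightarrow> f x \<in> carrier S"
    using f by (auto simp: idem_semiring_hom_def ring_hom_def)
  have M: "idem_module R ?M"
    by (rule idem_module_restrict_scalars[OF R R]) (simp add: idem_semiring_hom_def ring_hom_def)
  have N: "normal_module R ?N"
  proof (intro normal_module.intro normal_module_axioms.intro)
    show "idem_module R ?N"
      using idem_module_restrict_scalars[OF R S f] .
    fix s x y
    assume s: "s \<in> bounded_elements R" and xy: "x \<in> carrier ?N" "y \<in> carrier ?N"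
      and eq: "s \<odot>\<^bsub>?N\<^esub> x = s \<odot>\<^bsub>?N\<^esub> y"
    obtain a b where ab: "a \<in> carrier R" "x = f a" "b \<in> carrier R" "y = f b"
      using xy surj[symmetric] by (auto simp: restrict_scalars_def)
    have sc: "s \<in> carrier R"
      using s by (rule R.bounded_carrier)
    \<comment> \<open>Equality of these images lifts to stable equality with some witness
      \<open>t\<close>. Then \<open>t \<otimes> s\<close> is bounded and is a witness for
      \<open>a\<close> and \<open>b\<close>.\<close>
    have "f (s \<otimes>\<^bsub>R\<^esub> a) = f (s \<otimes>\<^bsub>R\<^esub> b)"
      using eq ab sc by (simp add: restrict_scalars_def hom)
    then obtain t where t: "t \<in> bounded_elements R"
      "t \<otimes>\<^bsub>R\<^esub> (s \<otimes>\<^bsub>R\<^esub> a) = t \<otimes>\<^bsub>R\<^esub> (s \<otimes>\<^bsub>R\<^esub> b)"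
      using ab sc ker by (auto simp: R.stably_eq_def)
    then have "(t \<otimes>\<^bsub>R\<^esub> s) \<otimes>\<^bsub>R\<^esub> a = (t \<otimes>\<^bsub>R\<^esub> s) \<otimes>\<^bsub>R\<^esub> b"
      using ab sc by (simp add: R.m_assoc R.bounded_carrier)
    then have "R.stably_eq a b"
      using R.bounded_mult[OF t(1) s] by (auto simp: R.stably_eq_def)
    then show "x = y"
      using ker ab by simp
  qed
  have fhom: "f \<in> idem_module_hom R ?M ?N"
    by (auto simp: idem_module_hom_def restrict_scalars_def hom)
  have "\<exists>!h. h \<in> idem_module_hom R ?N P \<inter> extensional (carrier ?N) \<and> (\<forall>x \<in> carrier ?M. h (f x) = g x)"
    if P: "normal_module R P" and g: "g \<in> idem_module_hom R ?M P" for P :: "('a, 'c) module" and g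
  proof -
    interpret P: normal_module R P by (rule P)
    have ghom: "\<And>x y. x \<in> carrier R \<Longrightarrow> y \<in> carrier R \<Longrightarrow> g (x \<oplus>\<^bsub>R\<^esub> y) = g x \<oplus>\<^bsub>P\<^esub> g y"
      "\<And>x y. x \<in> carrier R \<Longrightarrow> y \<in> carrier R \<Longrightarrow> g (x \<otimes>\<^bsub>R\<^esub> y) = x \<odot>\<^bsub>P\<^esub> g y"
      "g \<zero>\<^bsub>R\<^esub> = \<zero>\<^bsub>P\<^esub>" "\<And>x. x \<in> carrier R \<Longrightarrow> g x \<in> carrier P"
      using g by (auto simp: idem_module_hom_def restrict_scalars_def)
    have fact: "g x = g y" if xy: "x \<in> carrier R" "y \<in> carrier R" "f x = f y" for x y
    proof -
      obtain s where s: "s \<in> bounded_elements R" "s \<otimes>\<^bsub>R\<^esub> x = s \<otimes>\<^bsub>R\<^esub> y"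
        using xy ker by (auto simp: R.stably_eq_def)
      then have "s \<odot>\<^bsub>P\<^esub> g x = s \<odot>\<^bsub>P\<^esub> g y"
        using ghom(2) xy R.bounded_carrier by metis
      then show ?thesis
        using P.smult_cancel s(1) ghom(4) xy by blast
    qed
    \<comment> \<open>By \<open>fact\<close> the choice of the preimage does not affect the
      value.\<close>
    define h where "h = (\<lambda>y \<in> carrier S. g (inv_into (carrier R) f y))"
    have hf: "h (f x) = g x" if "x \<in> carrier R" for x
    proof -
      have "f x \<in> f ` carrier R"
        using that by blast
      then have "g (inv_into (carrier R) f (f x)) = g x"
        using that by (intro fact inv_into_into f_inv_into_f)
      then show ?thesis
        using that hom(4) by (simp add: h_def)
    qed
    have hhom: "h \<in> idem_module_hom R ?N P"
    proof -
      have "h y \<in> carrier P" if yz: "y \<in> carrier S" for y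
      proof -
        obtain a where "a \<in> carrier R" "y = f a"
          using yz surj by blast
        then show ?thesis
          by (simp add: hf ghom(4))
      qed
      moreover have "h \<zero>\<^bsub>S\<^esub> = \<zero>\<^bsub>P\<^esub>"
        using hf[of "\<zero>\<^bsub>R\<^esub>"] hom(3) ghom(3) by simp
      moreover have "h (y \<oplus>\<^bsub>S\<^esub> z) = h y \<oplus>\<^bsub>P\<^esub> h z" if yz: "y \<in> carrier S" "z \<in> carrier S" for y z
      proof -
        obtain a b where "a \<in> carrier R" "y = f a" "b \<in> carrier R" "z = f b"
          using yz surj by blast
        then show ?thesis
          using hf[of "a \<oplus>\<^bsub>R\<^esub> b"] by (simp add: hf hom ghom)
      qed
      moreover have "h (f a \<otimes>\<^bsub>S\<^esub> y) = a \<odot>\<^bsub>P\<^esub> h y" if yz: "a \<in> carrier R" "y \<in> carrier S" for a y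
      proof -
        obtain b where "b \<in> carrier R" "y = f b"
          using yz surj by blast
        then show ?thesis
          using hf[of "a \<otimes>\<^bsub>R\<^esub> b"] yz by (simp add: hf hom ghom)
      qed
      ultimately show ?thesis
        by (auto simp: idem_module_hom_def restrict_scalars_def)
    qed
    show ?thesis
    proof (rule ex1I[of _ h], intro conjI ballI IntI)
      show "h \<in> extensional (carrier ?N)"
        by (simp add: h_def restrict_scalars_def)
      fix h'
      assume h': "h' \<in> idem_module_hom R ?N P \<inter> extensional (carrier ?N) \<and>
        (\<forall>x \<in> carrier ?M. h' (f x) = g x)"
      show "h' = h"
      proof (rule extensionalityI[of _ "carrier S"])
        show "h' \<in> extensional (carrier S)" "h \<in> extensional (carrier S)"
          using h' by (auto simp: h_def restrict_scalars_def)
        fix y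
        assume "y \<in> carrier S"
        then obtain a where "a \<in> carrier R" "y = f a"
          using surj by blast
        then show "h' y = h y"
          using h' hf by (simp add: restrict_scalars_def)
      qed
    qed (use hhom hf in \<open>auto simp: restrict_scalars_def\<close>)
  qed
  then show ?thesis
    unfolding semiring_normalisation_def module_normalisation_def
    using R S f M N fhom by blast
qed

section \<open>Fourier--Motzkin elimination with real constants\<close>

text \<open>A triple \<open>(s, k, c)\<close> stands for \<open>k \<bullet> x + c < 0\<close> if \<open>s\<close> holds, and for \<open>k \<bullet> x + c \<le> 0\<close> otherwise.\<close>

type_synonym constr = "bool \<times> (nat \<Rightarrow> int) \<times> real"

definition neg :: "bool \<Rightarrow> real \<Rightarrow> bool" where
  "neg s r \<longleftrightarrow> (if s then r < 0 else r \<le> 0)"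

definition lin :: "nat \<Rightarrow> (nat \<Rightarrow> int) \<Rightarrow> point \<Rightarrow> real" where
  "lin n k x = (\<Sum>i<n. of_int (k i) * of_rat (x i))"

definition slope :: "constr \<Rightarrow> nat \<Rightarrow> int" where
  "slope p = fst (snd p)"

definition val :: "nat \<Rightarrow> point \<Rightarrow> constr \<Rightarrow> real" where
  "val n x p = lin n (slope p) x + snd (snd p)"

definition satisfies :: "nat \<Rightarrow> point \<Rightarrow> constr \<Rightarrow> bool" where
  "satisfies n x p \<longleftrightarrow> neg (fst p) (val n x p)"

definition cadd :: "constr \<Rightarrow> constr \<Rightarrow> constr" where
  "cadd = (\<lambda>(s, k, c) (s', k', c'). (s \<or> s', \<lambda>i. k i + k' i, c + c'))"

definition cscale :: "int \<Rightarrow> constr \<Rightarrow> constr" where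
  "cscale m = (\<lambda>(s, k, c). (s, \<lambda>i. m * k i, of_int m * c))"

lemma lin_add: "lin n (\<lambda>i. k i + k' i) x = lin n k x + lin n k' x"
  by (simp add: lin_def algebra_simps sum.distrib)

lemma lin_scale: "lin n (\<lambda>i. m * k i) x = of_int m * lin n k x"
  by (simp add: lin_def sum_distrib_left mult.assoc)

lemma slope_cadd [simp]: "slope (cadd p q) i = slope p i + slope q i"
  by (simp add: slope_def cadd_def split: prod.splits)

lemma slope_cscale [simp]: "slope (cscale m p) i = m * slope p i"
  by (simp add: slope_def cscale_def split: prod.splits)

lemma fst_cadd [simp]: "fst (cadd p q) \<longleftrightarrow> fst p \<or> fst q"
  by (simp add: cadd_def split: prod.splits)

lemma fst_cscale [simp]: "fst (cscale m p) = fst p"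
  by (simp add: cscale_def split: prod.splits)

lemma val_cadd [simp]: "val n x (cadd p q) = val n x p + val n x q"
  by (simp add: val_def slope_def cadd_def lin_add split: prod.splits)

lemma val_cscale [simp]: "val n x (cscale m p) = of_int m * val n x p"
  by (simp add: val_def slope_def cscale_def lin_scale algebra_simps split: prod.splits)

text \<open>A positive integer multiple is an iterated sum. This is why integer multipliers matter:
  an infeasibility certificate is a sum of constraints with repetitions.\<close>

lemma cscale_in_closed:
  assumes closed: "\<And>p q. p \<in> C \<Longrightarrow> q \<in> C \<Longrightarrow> cadd p q \<in> C" and p: "p \<in> C" and m: "0 < m"
  shows "cscale m p \<in> C"
proof -
  \<comment> \<open>The induction starts at 1, since the zero multiple of \<open>p\<close> may lie
    outside \<open>C\<close>.\<close>
  have *: "1 \<le> m" using m by simp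
  show ?thesis using *
  proof (induction m rule: int_ge_induct)
    case base
    then show ?case using p by (simp add: cscale_def split: prod.splits)
  next
    case (step i)
    have "cscale (i + 1) p = cadd (cscale i p) p"
      by (simp add: cscale_def cadd_def algebra_simps split: prod.splits)
    then show ?case using step closed p by simp
  qed
qed

lemma finite_rat_between:
  fixes L U :: "real set"
  assumes "finite L" "finite U" and lt: "\<And>l u. l \<in> L \<Longrightarrow> u \<in> U \<Longrightarrow> l < u"
  shows "\<exists>t :: rat. (\<forall>l \<in> L. l < of_rat t) \<and> (\<forall>u \<in> U. of_rat t < u)"
proof -
  have "\<exists>a. (\<forall>l \<in> L. l \<le> a) \<and> (\<forall>u \<in> U. a < u)"
  proof (cases "L = {}")
    case True
    \<comment> \<open>Inserting \<open>0\<close> keeps the minimum meaningful when \<open>U\<close>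
      is empty as well.\<close>
    have "Min (insert 0 U) - 1 < u" if "u \<in> U" for u
    proof -
      have "Min (insert 0 U) \<le> u"
        using that assms(2) by (intro Min_le) auto
      then show ?thesis by linarith
    qed
    with True show ?thesis by blast
  next
    case False
    then show ?thesis
      using assms by (intro exI[of _ "Max L"]) auto
  qed
  then obtain a where a: "\<forall>l \<in> L. l \<le> a" "\<forall>u \<in> U. a < u"
    by blast
  \<comment> \<open>The element \<open>a + 1\<close> provides an upper end for the interval when
    \<open>U\<close> is empty.\<close>
  define b where "b = Min (insert (a + 1) U)"
  have b: "\<forall>u \<in> U. b \<le> u" "a < b"
    using a assms(2) by (auto simp: b_def)
  obtain t :: rat where "a < of_rat t" "of_rat t < b"
    using of_rat_dense[OF b(2)] by blast
  then show ?thesis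
    using a b by (intro exI[of _ t]) force
qed

text \<open>
  Weak bounds are rational, so if a weak lower and a weak upper bound coincide, then their common
  value is a rational solution; otherwise there is room for one.
\<close>

lemma rational_solution_1d:
  fixes L U :: "(bool \<times> real) set"
  assumes fin: "finite L" "finite U"
    and comp: "\<And>s l s' u. (s, l) \<in> L \<Longrightarrow> (s', u) \<in> U \<Longrightarrow> neg (s \<or> s') (l - u)"
    and rat: "\<And>l. (False, l) \<in> L \<Longrightarrow> l \<in> \<rat>"
  shows "\<exists>t :: rat. (\<forall>(s, l) \<in> L. neg s (l - of_rat t)) \<and> (\<forall>(s, u) \<in> U. neg s (of_rat t - u))"
proof (cases "\<exists>l. (False, l) \<in> L \<and> (False, l) \<in> U")
  case True
  then obtain l where l: "(False, l) \<in> L" "(False, l) \<in> U"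
    by blast
  then obtain t where t: "l = of_rat t"
    using rat Rats_cases by blast
  \<comment> \<open>The other lower bounds are compared with the upper bound \<open>l\<close>, and
    the other upper bounds with the lower bound \<open>l\<close>.\<close>
  show ?thesis
    using comp[OF _ l(2)] comp[OF l(1)] unfolding t by (intro exI[of _ t]) auto
next
  case False
  \<comment> \<open>Only two weak bounds could coincide, and that case is excluded here.\<close>
  have "l < u" if "(s, l) \<in> L" "(s', u) \<in> U" for s l s' u
    using comp[OF that] False that by (cases s; cases s'; cases "l = u") (auto simp: neg_def)
  then obtain t :: rat where "\<forall>l \<in> snd ` L. l < of_rat t" "\<forall>u \<in> snd ` U. of_rat t < u"
    using finite_rat_between[of "snd ` L" "snd ` U"] fin by fastforce
  then show ?thesis
    by (intro exI[of _ t]) (force simp: neg_def)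
qed

lemma neg_scale: "0 < m \<Longrightarrow> neg s (m * r) \<longleftrightarrow> neg s r"
  by (auto simp: neg_def mult_less_0_iff mult_le_0_iff)

section \<open>Elimination of one variable\<close>

text \<open>The Fourier--Motzkin step for the variable with index \<open>n\<close>. The multipliers
  \<open>- slope q n\<close> and \<open>slope p n\<close> are positive integers, so slopes stay
  integral and no division occurs.\<close>

definition eliminate :: "nat \<Rightarrow> constr set \<Rightarrow> constr set" where
  "eliminate n A = {p \<in> A. slope p n = 0} \<union>
     (\<lambda>(p, q). cadd (cscale (- slope q n) p) (cscale (slope p n) q)) `
       ({p \<in> A. 0 < slope p n} \<times> {q \<in> A. slope q n < 0})"

lemma eliminate_cases:
  assumes "r \<in> eliminate n A"
  obtains "r \<in> A" "slope r n = 0"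
    | p q where "p \<in> A" "q \<in> A" "0 < slope p n" "slope q n < 0"
        "r = cadd (cscale (- slope q n) p) (cscale (slope p n) q)"
  using assms unfolding eliminate_def by (elim UnE imageE) (auto split: prod.splits)

text \<open>A combination is weak only if both of its parents are weak, so its constant is an
  integer combination of rational numbers.\<close>

lemma eliminate_rational:
  assumes rat: "\<And>p. p \<in> A \<Longrightarrow> \<not> fst p \<Longrightarrow> snd (snd p) \<in> \<rat>" and r: "r \<in> eliminate n A" "\<not> fst r"
  shows "snd (snd r) \<in> \<rat>"
  using r(1)
proof (cases rule: eliminate_cases)
  case 1
  then show ?thesis using rat r(2) by blast
next
  case (2 p q)
  have "snd (snd p) \<in> \<rat>" "snd (snd q) \<in> \<rat>"
    using 2 r(2) rat by auto
  moreover have "snd (snd r) = of_int (- slope q n) * snd (snd p) + of_int (slope p n) * snd (snd q)"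
    unfolding 2(5) by (simp add: cadd_def cscale_def split: prod.splits)
  ultimately show ?thesis
    by (simp only:) (intro Rats_add Rats_mult Rats_of_int)
qed

text \<open>With the coordinates below \<open>n\<close> fixed by \<open>x\<close>, each constraint
  involving the coordinate \<open>n\<close> bounds it from one side. The combined constraints say
  that these bounds are compatible.\<close>

lemma eliminate_complete:
  assumes fin: "finite A" and rat: "\<And>p. p \<in> A \<Longrightarrow> \<not> fst p \<Longrightarrow> snd (snd p) \<in> \<rat>"
    and x: "\<forall>p \<in> eliminate n A. satisfies n x p"
  shows "\<exists>y. \<forall>p \<in> A. satisfies (Suc n) y p"
proof -
  \<comment> \<open>The bound that a constraint imposes on the coordinate \<open>n\<close>, with its
    strictness. Dividing by a negative slope reverses the inequality, so negative slopes give lower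
    bounds.\<close>
  define bd where "bd = (\<lambda>p :: constr. (fst p, - val n x p / of_int (slope p n)))"
  define L where "L = bd ` {p \<in> A. slope p n < 0}"
  define U where "U = bd ` {p \<in> A. 0 < slope p n}"
  have "\<exists>t :: rat. (\<forall>(s, l) \<in> L. neg s (l - of_rat t)) \<and> (\<forall>(s, u) \<in> U. neg s (of_rat t - u))"
  proof (rule rational_solution_1d)
    show "finite L" "finite U"
      using fin by (simp_all add: L_def U_def)
  next
    fix s l s' u
    assume "(s, l) \<in> L" "(s', u) \<in> U"
    then obtain p q where q: "q \<in> A" "slope q n < 0" "s = fst q" "l = - val n x q / of_int (slope q n)"
      and p: "p \<in> A" "0 < slope p n" "s' = fst p" "u = - val n x p / of_int (slope p n)"
      by (auto simp: L_def U_def bd_def)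
    have "cadd (cscale (- slope q n) p) (cscale (slope p n) q) \<in> eliminate n A"
      unfolding eliminate_def using p(1,2) q(1,2) by (intro UnI2 image_eqI[of _ _ "(p, q)"]) auto
    then have "satisfies n x (cadd (cscale (- slope q n) p) (cscale (slope p n) q))"
      using x by blast
    then have "neg (s \<or> s') (of_int (- slope q n) * val n x p + of_int (slope p n) * val n x q)"
      unfolding satisfies_def p(3) q(3) by (simp add: disj_commute)
    \<comment> \<open>The combined constraint is the comparison of the two bounds, scaled by a
      positive integer.\<close>
    also have "of_int (- slope q n) * val n x p + of_int (slope p n) * val n x q =
        of_int (- slope q n * slope p n) * (l - u)"
      using p(2) q(2) unfolding p(4) q(4) by (simp add: field_simps)
    finally show "neg (s \<or> s') (l - u)"
      using p(2) q(2) by (subst (asm) neg_scale) (simp_all add: mult_neg_pos)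
  next
    fix l
    assume "(False, l) \<in> L"
    then obtain p where p: "p \<in> A" "\<not> fst p" "l = - val n x p / of_int (slope p n)"
      by (auto simp: L_def bd_def)
    \<comment> \<open>The point \<open>x\<close> is rational, so the bound inherits rationality from
      the constant of \<open>p\<close>.\<close>
    have "lin n (slope p) x \<in> \<rat>"
      unfolding lin_def by (intro Rats_sum Rats_mult) auto
    then show "l \<in> \<rat>"
      unfolding p(3) val_def using rat[OF p(1,2)]
      by (intro Rats_divide Rats_minus_iff[THEN iffD2] Rats_add) auto
  qed
  then obtain t :: rat where t: "\<forall>(s, l) \<in> L. neg s (l - of_rat t)" "\<forall>(s, u) \<in> U. neg s (of_rat t - u)"
    by blast
  define y where "y = x(n := t)"
  have lin_y: "lin (Suc n) k y = lin n k x + of_int (k n) * of_rat t" for k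
    by (simp add: lin_def y_def)
  have "satisfies (Suc n) y p" if p: "p \<in> A" for p
  proof -
    have eq: "satisfies (Suc n) y p \<longleftrightarrow> neg (fst p) (val n x p + of_int (slope p n) * of_rat t)"
      by (simp add: satisfies_def lin_y val_def algebra_simps)
    consider "slope p n = 0" | "slope p n < 0" | "0 < slope p n"
      by linarith
    then show ?thesis
    proof cases
      case 1
      then have "satisfies n x p"
        using x p by (simp add: eliminate_def)
      then show ?thesis
        using 1 unfolding eq by (simp add: satisfies_def)
    next
      case 2
      have "neg (fst p) (- val n x p / of_int (slope p n) - of_rat t)"
        using bspec[OF t(1), of "bd p"] p 2 by (simp add: L_def bd_def)
      then have "neg (fst p) (of_int (- slope p n) * (- val n x p / of_int (slope p n) - of_rat t))"
        using 2 by (subst neg_scale) simp_all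
      then show ?thesis
        using 2 by (simp add: eq algebra_simps)
    next
      case 3
      have "neg (fst p) (of_rat t - - val n x p / of_int (slope p n))"
        using bspec[OF t(2), of "bd p"] p 3 by (simp add: U_def bd_def)
      then have "neg (fst p) (of_int (slope p n) * (of_rat t - - val n x p / of_int (slope p n)))"
        using 3 by (subst neg_scale) simp_all
      then show ?thesis
        using 3 by (simp add: eq algebra_simps)
    qed
  qed
  then show ?thesis by blast
qed

text \<open>The set \<open>C\<close> replaces a record of the multipliers: any property of
  constraints that is stable under addition and holds on \<open>A\<close> also holds for the
  contradictory constraint obtained at the end.\<close>

lemma fourier_motzkin:
  assumes "finite A" "A \<subseteq> C" "\<And>p. p \<in> A \<Longrightarrow> \<not> fst p \<Longrightarrow> snd (snd p) \<in> \<rat>"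
    and "\<And>p q. p \<in> C \<Longrightarrow> q \<in> C \<Longrightarrow> cadd p q \<in> C"
    and "\<nexists>x. \<forall>p \<in> A. satisfies n x p"
  shows "\<exists>p \<in> C. (\<forall>i<n. slope p i = 0) \<and> \<not> neg (fst p) (snd (snd p))"
  using assms
proof (induction n arbitrary: A C)
  case 0
  then show ?case
    by (auto simp: satisfies_def val_def lin_def)
next
  case (Suc n)
  \<comment> \<open>Shrinking \<open>C\<close> records that the coordinate \<open>n\<close> is gone;
    sums cannot bring it back.\<close>
  define C' where "C' = {p \<in> C. slope p n = 0}"
  have "\<exists>p \<in> C'. (\<forall>i<n. slope p i = 0) \<and> \<not> neg (fst p) (snd (snd p))"
  proof (rule Suc.IH[of "eliminate n A"])
    show "finite (eliminate n A)"
      using Suc.prems(1) by (simp add: eliminate_def)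
    show "eliminate n A \<subseteq> C'"
    proof
      fix r assume "r \<in> eliminate n A"
      then show "r \<in> C'"
        using Suc.prems(2) cscale_in_closed[where C = C, OF Suc.prems(4)] Suc.prems(4)
        by (cases rule: eliminate_cases) (simp_all add: C'_def subsetD)
    qed
    show "snd (snd p) \<in> \<rat>" if "p \<in> eliminate n A" "\<not> fst p" for p
      using eliminate_rational[OF Suc.prems(3) that] .
    show "cadd p q \<in> C'" if "p \<in> C'" "q \<in> C'" for p q
      using that Suc.prems(4) by (simp add: C'_def)
    show "\<nexists>x. \<forall>p \<in> eliminate n A. satisfies n x p"
      using eliminate_complete[OF Suc.prems(1,3)] Suc.prems(5) by blast
  qed
  then show ?case
    unfolding C'_def by (auto simp: less_Suc_eq)
qed

section \<open>The semiring of fractional ideals\<close>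

text \<open>Here \<open>Qp\<close> consists of the elements below \<open>\<one>\<close>, and
  \<open>a\<close> is below \<open>b\<close> when \<open>a \<in> b <# Qp\<close>. The assumption
  \<open>upper_bound\<close> becomes the Tate condition for fractional ideals.\<close>

locale preordered_group = comm_group Q + Qp: submonoid Qp Q
  for Q (structure) and Qp +
  assumes upper_bound: "\<lbrakk>finite G; G \<subseteq> carrier Q\<rbrakk> \<Longrightarrow> \<exists>u \<in> carrier Q. G \<subseteq> u <# Qp"
begin

abbreviation "gen \<equiv> ideal_gen Q Qp"
abbreviation "FI \<equiv> frac_ideals Q Qp"

lemma gen_eq_set_mult: "gen G = G <#> Qp"
  by (auto simp: ideal_gen_def l_coset_def set_mult_def)

lemma set_mult_comm: "A \<subseteq> carrier Q \<Longrightarrow> B \<subseteq> carrier Q \<Longrightarrow> A <#> B = B <#> A"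
  unfolding set_mult_def using m_comm by blast

lemma Qp_idem: "Qp <#> Qp = Qp"
proof
  show "Qp <#> Qp \<subseteq> Qp"
    by (auto simp: set_mult_def)
  show "Qp \<subseteq> Qp <#> Qp"
  proof
    fix q assume "q \<in> Qp"
    then have "\<one> \<otimes> q \<in> Qp <#> Qp"
      unfolding set_mult_def using Qp.one_closed by blast
    then show "q \<in> Qp <#> Qp"
      using \<open>q \<in> Qp\<close> Qp.subset by auto
  qed
qed

lemma Qp_nonempty: "Qp \<noteq> {}"
  using Qp.one_closed by blast

lemma gen_closed: "G \<subseteq> carrier Q \<Longrightarrow> gen G \<subseteq> carrier Q"
  using Qp.subset by (auto simp: gen_eq_set_mult set_mult_def)

text \<open>The first copy of \<open>Qp\<close> is moved past \<open>H\<close> by commutativity and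
  merges with the second by \<open>Qp_idem\<close>.\<close>

lemma gen_mult:
  assumes "G \<subseteq> carrier Q" "H \<subseteq> carrier Q"
  shows "gen G <#> gen H = gen (G <#> H)"
proof -
  note c = assms Qp.subset set_mult_closed
  have "gen G <#> gen H = G <#> ((Qp <#> H) <#> Qp)"
    unfolding gen_eq_set_mult using c by (simp add: set_mult_assoc)
  also have "\<dots> = G <#> (H <#> (Qp <#> Qp))"
    using c by (simp add: set_mult_assoc set_mult_comm[of Qp H])
  finally show ?thesis
    using c by (simp add: Qp_idem gen_eq_set_mult set_mult_assoc)
qed

lemma gen_one: "gen {\<one>} = Qp"
  using Qp.subset by (force simp: ideal_gen_def l_coset_def)

lemma finite_set_mult: "finite G \<Longrightarrow> finite H \<Longrightarrow> finite (G <#> H)"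
  by (simp add: set_mult_def)

lemma gen_mem: "g \<in> G \<Longrightarrow> G \<subseteq> carrier Q \<Longrightarrow> g \<in> gen G"
  using Qp.one_closed r_one[of g] unfolding ideal_gen_def l_coset_def by (metis UN_I singletonI subsetD)

lemma gen_down: "G \<subseteq> carrier Q \<Longrightarrow> x \<in> gen G \<Longrightarrow> q \<in> Qp \<Longrightarrow> x \<otimes> q \<in> gen G"
proof -
  assume G: "G \<subseteq> carrier Q" and "x \<in> gen G" and q: "q \<in> Qp"
  then obtain g p where gp: "g \<in> G" "p \<in> Qp" "x = g \<otimes> p"
    by (auto simp: ideal_gen_def l_coset_def)
  then have "x \<otimes> q = g \<otimes> (p \<otimes> q)"
    using G q Qp.subset by (simp add: m_assoc subset_iff)
  moreover have "p \<otimes> q \<in> Qp"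
    using gp(2) q by (rule Qp.m_closed)
  ultimately show ?thesis
    using gp(1) by (auto simp: ideal_gen_def l_coset_def)
qed

section \<open>The semiring operations on fractional ideals\<close>

lemma FI_sel [simp]:
  "mult FI = (\<lambda>I J. I <#> J)" "one FI = Qp" "zero FI = {}" "add FI = (\<union>)"
  by (simp_all add: frac_ideals_def)

lemma carrier_FI: "carrier FI = {gen G | G. finite G \<and> G \<subseteq> carrier Q}"
  by (simp add: frac_ideals_def)

lemma gen_in_FI: "finite G \<Longrightarrow> G \<subseteq> carrier Q \<Longrightarrow> gen G \<in> carrier FI"
  unfolding carrier_FI by blast

lemma FI_cases:
  assumes "I \<in> carrier FI"
  obtains G where "finite G" "G \<subseteq> carrier Q" "I = gen G"
  using assms unfolding carrier_FI by blast

lemma FI_subset: "I \<in> carrier FI \<Longrightarrow> I \<subseteq> carrier Q"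
  using gen_closed by (auto elim!: FI_cases)

lemma gen_Un: "gen G \<union> gen H = gen (G \<union> H)"
  by (simp add: ideal_gen_def)

lemma FI_mult_closed: "I \<in> carrier FI \<Longrightarrow> J \<in> carrier FI \<Longrightarrow> I <#> J \<in> carrier FI"
  by (elim FI_cases) (simp add: gen_mult gen_in_FI finite_set_mult set_mult_closed)

lemma FI_Un_closed: "I \<in> carrier FI \<Longrightarrow> J \<in> carrier FI \<Longrightarrow> I \<union> J \<in> carrier FI"
  by (elim FI_cases) (simp add: gen_Un gen_in_FI)

lemma FI_one_closed: "Qp \<in> carrier FI"
  using gen_in_FI[of "{\<one>}"] by (simp add: gen_one)

lemma FI_zero_closed: "{} \<in> carrier FI"
  using gen_in_FI[of "{}"] by (simp add: ideal_gen_def)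

lemma FI_one_mult: "I \<in> carrier FI \<Longrightarrow> Qp <#> I = I"
proof (elim FI_cases)
  fix G assume G: "finite G" "G \<subseteq> carrier Q" "I = gen G"
  have "Qp <#> I = gen ({\<one>} <#> G)"
    using gen_mult[of "{\<one>}" G] G by (simp add: gen_one)
  also have "{\<one>} <#> G = G"
    using G(2) by (force simp: set_mult_def)
  finally show ?thesis using G by simp
qed

lemma principal_mult:
  "g \<in> carrier Q \<Longrightarrow> h \<in> carrier Q \<Longrightarrow> gen {g} <#> gen {h} = gen {g \<otimes> h}"
  using gen_mult[of "{g}" "{h}"] by (simp add: set_mult_def)

lemma principal_unit:
  assumes "g \<in> carrier Q"
  shows "gen {g} \<in> Units FI"
proof -
  have "gen {g} <#> gen {inv g} = Qp" "gen {inv g} <#> gen {g} = Qp"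
    using assms by (simp_all add: principal_mult gen_one)
  then show ?thesis
    unfolding Units_def using assms
    by (auto intro!: gen_in_FI bexI[of _ "gen {inv g}"])
qed

lemma FI_semiring: "semiring FI" "comm_monoid FI"
proof -
  have cm: "comm_monoid FI"
  proof (rule comm_monoidI)
    show "I \<otimes>\<^bsub>FI\<^esub> J = J \<otimes>\<^bsub>FI\<^esub> I" if "I \<in> carrier FI" "J \<in> carrier FI" for I J
      using that set_mult_comm FI_subset by simp
  qed (simp_all add: FI_mult_closed FI_one_closed FI_one_mult FI_subset set_mult_assoc)
  then interpret comm_monoid FI .
  have "abelian_monoid FI"
    by unfold_locales (auto intro: FI_Un_closed FI_zero_closed)
  then interpret abelian_monoid FI .
  show "semiring FI"
    by unfold_locales (auto simp: set_mult_def)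
  show "comm_monoid FI" by (rule cm)
qed

text \<open>If \<open>u\<close> bounds the generators of an ideal, the ideal lies in
  \<open>gen {u}\<close>, which is invertible; this gives the Tate condition.\<close>

sublocale FI: idem_semiring FI
proof (intro idem_semiring.intro FI_semiring idem_semiring_axioms.intro)
  fix I assume "I \<in> carrier FI"
  show "I \<oplus>\<^bsub>FI\<^esub> I = I" by simp
  obtain G where G: "finite G" "G \<subseteq> carrier Q" "I = gen G"
    using \<open>I \<in> carrier FI\<close> by (rule FI_cases)
  obtain u where u: "u \<in> carrier Q" "G \<subseteq> u <# Qp"
    using upper_bound G by blast
  have "G \<subseteq> gen {u}"
    using u by (simp add: ideal_gen_def)
  then have "I \<subseteq> gen {u}"
    using gen_down[of "{u}"] u(1) unfolding G(3) ideal_gen_def[of Q Qp G] l_coset_def by auto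
  then show "\<exists>u \<in> Units FI. idem_le FI I u"
    using principal_unit[OF u(1)] by (auto simp: idem_le_def)
qed

text \<open>A nonempty ideal contains the principal ideal of any of its generators, and this is a
  unit. The empty ideal absorbs products, so it is not a unit and has no unit below it.\<close>

lemma bounded_iff: "I \<in> bounded_elements FI \<longleftrightarrow> I \<in> carrier FI \<and> I \<noteq> {}"
proof
  assume I: "I \<in> bounded_elements FI"
  have "{} \<notin> Units FI"
    using Qp_nonempty by (auto simp: Units_def set_mult_def)
  then show "I \<in> carrier FI \<and> I \<noteq> {}"
    using I by (auto simp: bounded_elements_def idem_le_def)
next
  assume I: "I \<in> carrier FI \<and> I \<noteq> {}"
  then obtain G where G: "finite G" "G \<subseteq> carrier Q" "I = gen G"
    by (blast elim: FI_cases)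
  then obtain g where g: "g \<in> G"
    using I by (auto simp: ideal_gen_def)
  have "idem_le FI (gen {g}) I"
    using g by (auto simp: idem_le_def G(3) ideal_gen_def)
  then show "I \<in> bounded_elements FI"
    using I g G(2) principal_unit FI.tate unfolding bounded_elements_def by blast
qed

section \<open>Powers of ideals and integral dependence\<close>

lemma principal_pow:
  assumes "g \<in> carrier Q"
  shows "gen {g} [^]\<^bsub>FI\<^esub> (m :: nat) = gen {g [^] m}"
  using assms by (induction m) (simp_all add: gen_one principal_mult)

lemma prod_in_pow:
  assumes "G \<subseteq> carrier Q" "finite G" "set hs \<subseteq> G"
  shows "foldr (\<otimes>) hs \<one> \<in> gen G [^]\<^bsub>FI\<^esub> length hs"
  using assms(3)
proof (induction hs)
  case Nil
  then show ?case by simp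
next
  case (Cons h hs)
  have "gen G [^]\<^bsub>FI\<^esub> length (h # hs) = gen G <#> gen G [^]\<^bsub>FI\<^esub> length hs"
    using FI.nat_pow_Suc2[OF gen_in_FI[OF assms(2,1)]] by simp
  then show ?case
    using Cons gen_mem[of h G] assms(1) by (auto simp: set_mult_def)
qed

text \<open>The equation places the power of \<open>g\<close> in the power of \<open>gen G\<close>
  with the same exponent, so \<open>stably_eq_of_pow_le\<close> applies to \<open>gen {g}\<close>
  and \<open>gen G\<close>.\<close>

lemma stably_eq_of_integral:
  assumes G: "finite G" "G \<subseteq> carrier Q" and g: "g \<in> carrier Q"
    and hs: "hs \<noteq> []" "set hs \<subseteq> G" and q: "q \<in> Qp" and eq: "g [^] length hs = foldr (\<otimes>) hs \<one> \<otimes> q"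
  shows "FI.stably_eq (gen (insert g G)) (gen G)"
proof -
  obtain m where m: "length hs = Suc m"
    using hs(1) by (cases hs) auto
  have J: "gen G \<in> carrier FI" and u: "gen {g} \<in> carrier FI"
    using G g by (auto intro: gen_in_FI)
  have ne: "gen {g} \<noteq> {}"
    using gen_mem[of g "{g}"] g by auto
  obtain H where H: "H \<subseteq> carrier Q" "gen G [^]\<^bsub>FI\<^esub> length hs = gen H"
    using FI.nat_pow_closed[OF J, of "length hs"] by (auto elim!: FI_cases)
  have "g [^] length hs \<in> gen H"
    using gen_down[OF H(1) _ q] prod_in_pow[OF G(2,1) hs(2)] H(2) eq by simp
  then have "gen {g [^] length hs} \<subseteq> gen H"
    using gen_down[OF H(1)] unfolding ideal_gen_def[of Q Qp "{_}"] l_coset_def by auto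
  then have le: "idem_le FI (gen {g} [^]\<^bsub>FI\<^esub> length hs) (gen G [^]\<^bsub>FI\<^esub> length hs)"
    unfolding principal_pow[OF g] H(2) by (auto simp: idem_le_def)
  have "FI.stably_eq (gen {g} \<oplus>\<^bsub>FI\<^esub> gen G) (gen G)"
    by (rule FI.stably_eq_of_pow_le[OF u J _ _ le[unfolded m]])
      (use bounded_iff ne J u FI_Un_closed FI_one_closed Qp_nonempty in auto)
  then show ?thesis
    by (simp add: gen_Un)
qed

end

section \<open>Evaluation of fractional ideals\<close>

abbreviation "AG \<equiv> affine_group"

lemma AG_sel [simp]:
  "carrier (AG n) = {affine_fun n k c | k c. True}"
  "mult (AG n) = (\<lambda>f g. \<lambda>x \<in> rat_space n. f x + g x)"
  "one (AG n) = (\<lambda>x \<in> rat_space n. 0)"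
  by (simp_all add: affine_group_def)

lemma affine_fun_eq: "x \<in> rat_space n \<Longrightarrow> affine_fun n k c x = lin n k x + c"
  by (simp add: affine_fun_def lin_def)

lemma affine_fun_add:
  "(\<lambda>x \<in> rat_space n. affine_fun n k c x + affine_fun n k' c' x) = affine_fun n (\<lambda>i. k i + k' i) (c + c')"
  by (rule ext) (simp add: affine_fun_def algebra_simps sum.distrib)

lemma affine_fun_zero: "(\<lambda>x \<in> rat_space n. 0) = affine_fun n (\<lambda>_. 0) 0"
  by (rule ext) (simp add: affine_fun_def)

lemma affine_group_comm_group: "comm_group (AG n)"
proof (rule comm_groupI)
  fix f assume "f \<in> carrier (AG n)"
  then obtain k c where f: "f = affine_fun n k c" by auto
  show "\<one>\<^bsub>AG n\<^esub> \<otimes>\<^bsub>AG n\<^esub> f = f"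
    by (simp add: f affine_fun_zero affine_fun_add)
  show "\<exists>g \<in> carrier (AG n). g \<otimes>\<^bsub>AG n\<^esub> f = \<one>\<^bsub>AG n\<^esub>"
    by (intro bexI[of _ "affine_fun n (\<lambda>i. - k i) (- c)"])
      (auto simp: f affine_fun_zero affine_fun_add)
qed (auto simp: affine_fun_zero affine_fun_add algebra_simps, blast)

lemma affine_bounded:
  assumes D: "\<Delta> \<subseteq> rat_space n" and b: "bounded_points n \<Delta>" and g: "g \<in> carrier (AG n)"
  shows "\<exists>M. \<forall>x \<in> \<Delta>. g x \<le> M"
proof -
  obtain b where b: "\<And>x i. x \<in> \<Delta> \<Longrightarrow> i < n \<Longrightarrow> \<bar>x i\<bar> \<le> b"
    using assms(2) unfolding bounded_points_def by blast
  obtain k c where g: "g = affine_fun n k c"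
    using assms(3) by auto
  have "g x \<le> (\<Sum>i<n. \<bar>of_int (k i)\<bar> * of_rat b) + c" if x: "x \<in> \<Delta>" for x
  proof -
    have "(of_int (k i) :: real) * of_rat (x i) \<le> \<bar>of_int (k i)\<bar> * of_rat b" if "i < n" for i
    proof -
      have "(of_int (k i) :: real) * of_rat (x i) \<le> \<bar>of_int (k i)\<bar> * \<bar>of_rat (x i)\<bar>"
        using abs_ge_self[of "of_int (k i) * of_rat (x i) :: real"] by (simp only: abs_mult)
      also have "\<dots> \<le> \<bar>of_int (k i)\<bar> * of_rat b"
      proof (rule mult_left_mono)
        have "x i \<le> b" "- b \<le> x i"
          using b[OF x \<open>i < n\<close>] by linarith+
        then have "of_rat (x i) \<le> (of_rat b :: real)" "- of_rat b \<le> (of_rat (x i) :: real)"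
          by (simp_all add: of_rat_less_eq flip: of_rat_minus)
        then show "\<bar>of_rat (x i) :: real\<bar> \<le> of_rat b"
          by linarith
      qed simp
      finally show ?thesis .
    qed
    then have "lin n k x \<le> (\<Sum>i<n. \<bar>of_int (k i)\<bar> * of_rat b)"
      unfolding lin_def by (intro sum_mono) simp
    then show ?thesis
      using x D by (simp add: g affine_fun_eq subsetD)
  qed
  then show ?thesis by blast
qed

lemma preordered_affine_group:
  assumes D: "\<Delta> \<subseteq> rat_space n" and b: "bounded_points n \<Delta>"
  shows "preordered_group (AG n) (nonpos_on n \<Delta>)"
proof (intro preordered_group.intro preordered_group_axioms.intro affine_group_comm_group submonoid.intro)
  show "nonpos_on n \<Delta> \<subseteq> carrier (AG n)"
    by (auto simp: nonpos_on_def)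
  show "\<one>\<^bsub>AG n\<^esub> \<in> nonpos_on n \<Delta>"
    using zero_in_nonpos_on[OF D] by simp
  interpret comm_group "AG n"
    by (rule affine_group_comm_group)
  show "f \<otimes>\<^bsub>AG n\<^esub> g \<in> nonpos_on n \<Delta>" if "f \<in> nonpos_on n \<Delta>" "g \<in> nonpos_on n \<Delta>" for f g
    using that m_closed[of f g] D unfolding nonpos_on_def by (auto simp del: AG_sel(1) intro: add_nonpos_nonpos)
  fix G :: "(point \<Rightarrow> real) set"
  assume G: "finite G" "G \<subseteq> carrier (AG n)"
  have "\<forall>g \<in> G. \<exists>M. \<forall>x \<in> \<Delta>. g x \<le> M"
    using affine_bounded[OF D b] G(2) by blast
  then obtain M where M: "\<And>g x. g \<in> G \<Longrightarrow> x \<in> \<Delta> \<Longrightarrow> g x \<le> M g"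
    by metis
  \<comment> \<open>Inserting \<open>0\<close> covers the case of an empty \<open>G\<close>.\<close>
  define m where "m = Max (insert 0 (M ` G))"
  have m: "g x \<le> m" if "g \<in> G" "x \<in> \<Delta>" for g x
  proof -
    have "M g \<le> m"
      unfolding m_def using that G(1) by (intro Max_ge) auto
    then show ?thesis
      using M[OF that] by linarith
  qed
  \<comment> \<open>The upper bound is a constant function, so subtracting it changes only the
    constant terms of the elements of \<open>G\<close>.\<close>
  define u where "u = affine_fun n (\<lambda>_. 0) m"
  have u: "u \<in> carrier (AG n)"
    by (auto simp: u_def)
  have "g \<in> u <#\<^bsub>AG n\<^esub> nonpos_on n \<Delta>" if "g \<in> G" for g
  proof -
    obtain k c where g: "g = affine_fun n k c"
      using G(2) \<open>g \<in> G\<close> by auto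
    have "affine_fun n k (c - m) \<in> nonpos_on n \<Delta>"
      using m[OF \<open>g \<in> G\<close>] D by (force simp: nonpos_on_def affine_fun_eq g subset_iff)
    moreover have "g = u \<otimes>\<^bsub>AG n\<^esub> affine_fun n k (c - m)"
      by (simp add: u_def g affine_fun_add)
    ultimately show ?thesis
      unfolding l_coset_def by blast
  qed
  then show "\<exists>u \<in> carrier (AG n). G \<subseteq> u <#\<^bsub>AG n\<^esub> nonpos_on n \<Delta>"
    using u by blast
qed

lemma foldr_affine_eval:
  "x \<in> rat_space n \<Longrightarrow> foldr (mult (AG n)) hs (one (AG n)) x = (\<Sum>h\<leftarrow>hs. h x)"
  by (induction hs) simp_all

lemma pow_affine_eval:
  "x \<in> rat_space n \<Longrightarrow> (g [^]\<^bsub>AG n\<^esub> (m :: nat)) x = of_nat m * g x"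
  by (induction m) (simp_all add: nat_pow_def algebra_simps)

lemma max_on_Un:
  assumes "finite G" "G \<noteq> {}" "finite H" "H \<noteq> {}"
  shows "max_on \<Delta> (G \<union> H) = (\<lambda>x \<in> \<Delta>. max (max_on \<Delta> G x) (max_on \<Delta> H x))"
  by (rule ext) (use assms in \<open>simp add: max_on_def image_Un Max_Un\<close>)

text \<open>The two generators are chosen independently, so a pair of maximisers attains the sum of
  the maxima.\<close>

lemma max_on_set_mult:
  assumes D: "\<Delta> \<subseteq> rat_space n" and G: "finite G" "G \<noteq> {}" and H: "finite H" "H \<noteq> {}"
  shows "max_on \<Delta> (G <#>\<^bsub>AG n\<^esub> H) = (\<lambda>x \<in> \<Delta>. max_on \<Delta> G x + max_on \<Delta> H x)"
proof (rule ext)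
  fix x
  show "max_on \<Delta> (G <#>\<^bsub>AG n\<^esub> H) x = (\<lambda>x \<in> \<Delta>. max_on \<Delta> G x + max_on \<Delta> H x) x"
  proof (cases "x \<in> \<Delta>")
    case x: True
    let ?e = "\<lambda>g :: point \<Rightarrow> real. g x"
    have mult_eval: "(g \<otimes>\<^bsub>AG n\<^esub> h) x = g x + h x" for g h
      using x D by auto
    have "Max (?e ` (G <#>\<^bsub>AG n\<^esub> H)) = Max (?e ` G) + Max (?e ` H)"
    proof (rule Max_eqI)
      show "finite (?e ` (G <#>\<^bsub>AG n\<^esub> H))"
        using G H by (simp add: set_mult_def)
      show "y \<le> Max (?e ` G) + Max (?e ` H)" if "y \<in> ?e ` (G <#>\<^bsub>AG n\<^esub> H)" for y
        using that G H mult_eval by (auto simp: set_mult_def simp del: AG_sel intro!: add_mono)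
      obtain g h where gh: "g \<in> G" "h \<in> H" "Max (?e ` G) = g x" "Max (?e ` H) = h x"
        using Max_in[of "?e ` G"] Max_in[of "?e ` H"] G H unfolding image_iff by blast
      have "g \<otimes>\<^bsub>AG n\<^esub> h \<in> G <#>\<^bsub>AG n\<^esub> H"
        using gh(1,2) unfolding set_mult_def by blast
      then show "Max (?e ` G) + Max (?e ` H) \<in> ?e ` (G <#>\<^bsub>AG n\<^esub> H)"
        unfolding gh(3,4) mult_eval[symmetric] by (rule imageI)
    qed
    then show ?thesis
      using x by (simp add: max_on_def)
  qed (simp add: max_on_def)
qed

section \<open>Integral dependence over a polytope\<close>

lemma polytope_subset: "rational_polytope n \<Delta> \<Longrightarrow> \<Delta> \<subseteq> rat_space n"
  by (auto simp: rational_polytope_def)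

text \<open>
  The system consisting of the inequalities of \<open>\<Delta>\<close> and of \<open>h - g < 0\<close> for \<open>h \<in> G\<close> has no solution,
  and the certificate of infeasibility produced by elimination has integer coefficients.
\<close>

lemma integral_dependence:
  assumes poly: "rational_polytope n \<Delta>" and ne: "\<Delta> \<noteq> {}"
    and G: "finite G" "G \<subseteq> carrier (AG n)" and g: "g \<in> carrier (AG n)"
    and dom: "\<And>x. x \<in> \<Delta> \<Longrightarrow> \<exists>h \<in> G. g x \<le> h x"
  shows "\<exists>hs. hs \<noteq> [] \<and> set hs \<subseteq> G \<and> (\<forall>x \<in> \<Delta>. of_nat (length hs) * g x \<le> (\<Sum>h\<leftarrow>hs. h x))"
proof -
  have D: "\<Delta> \<subseteq> rat_space n"
    using poly by (rule polytope_subset)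
  obtain P :: "((nat \<Rightarrow> int) \<times> rat \<times> rat) set" where P: "finite P"
    "\<Delta> = {x \<in> rat_space n. \<forall>(k, c, l) \<in> P. (\<Sum>i<n. of_int (k i) * x i) + c \<le> l}"
    using poly unfolding rational_polytope_def by blast
  have lin_rat: "lin n k x = of_rat (\<Sum>i<n. of_int (k i) * x i)" for k x
    by (simp add: lin_def of_rat_sum of_rat_mult)
  have ineq: "lin n k x + of_rat (c - l) \<le> 0 \<longleftrightarrow> (\<Sum>i<n. of_int (k i) * x i) + c \<le> l" for k x c l
  proof -
    have "lin n k x + of_rat (c - l) = of_rat ((\<Sum>i<n. of_int (k i) * x i) + c - l)"
      unfolding lin_rat by (simp add: of_rat_add of_rat_diff)
    then show ?thesis by simp
  qed
  obtain k0 c0 where g_eq: "g = affine_fun n k0 c0"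
    using g by auto
  have "\<forall>h \<in> G. \<exists>k c. h = affine_fun n k c"
    using G(2) by auto
  then obtain K C where KC: "\<And>h. h \<in> G \<Longrightarrow> h = affine_fun n (K h) (C h)"
    by metis
  \<comment> \<open>\<open>W\<close> expresses membership in the polytope by weak constraints with
    rational constants; \<open>T\<close> says that \<open>g\<close> strictly exceeds every element
    of \<open>G\<close>, with real constants.\<close>
  define W where "W = (\<lambda>(k, c, l). (False, k, of_rat (c - l)) :: constr) ` P"
  define T where "T = (\<lambda>h. (True, \<lambda>i. K h i + - k0 i, C h - c0) :: constr) ` G"
  have T_val: "lin n (\<lambda>i. K h i + - k0 i) x + (C h - c0) = h y - g y"
    if "h \<in> G" "y \<in> rat_space n" "\<And>i. i < n \<Longrightarrow> y i = x i" for h x y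
  proof -
    have "lin n k y = lin n k x" for k
      using that(3) by (simp add: lin_def)
    then show ?thesis
      using that(2) affine_fun_eq[OF that(2), of "K h" "C h"] KC[OF that(1)] lin_scale[of n "-1" k0 x]
      unfolding lin_add by (simp add: g_eq affine_fun_eq)
  qed
  \<comment> \<open>The invariant carried through elimination: \<open>W\<close> lies in
    \<open>Z\<close> with the empty list, \<open>T\<close> with singletons, and sums of constraints
    append lists. A strict constraint must come with a nonempty list.\<close>
  define Z where "Z = {p :: constr. \<exists>hs. set hs \<subseteq> G \<and> (fst p \<longrightarrow> hs \<noteq> []) \<and>
    (\<forall>x \<in> \<Delta>. val n x p \<le> (\<Sum>h\<leftarrow>hs. h x - g x))}"
  have "\<exists>p \<in> Z. (\<forall>i<n. slope p i = 0) \<and> \<not> neg (fst p) (snd (snd p))"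
  proof (rule fourier_motzkin[of "W \<union> T"])
    show "finite (W \<union> T)"
      using P(1) G(1) by (simp add: W_def T_def)
    have "p \<in> Z" if "p \<in> W" for p
    proof -
      obtain k c l where p: "(k, c, l) \<in> P" "p = (False, k, of_rat (c - l))"
        using \<open>p \<in> W\<close> by (auto simp: W_def)
      have "lin n k x + of_rat (c - l) \<le> 0" if "x \<in> \<Delta>" for x
        unfolding ineq using P(2) p(1) that by auto
      then show ?thesis
        unfolding Z_def p(2) by (auto simp: val_def slope_def intro!: exI[of _ "[]"])
    qed
    moreover have "p \<in> Z" if "p \<in> T" for p
    proof -
      obtain h where h: "h \<in> G" "p = (True, \<lambda>i. K h i + - k0 i, C h - c0)"
        using \<open>p \<in> T\<close> unfolding T_def by blast
      have "val n x p = h x - g x" if "x \<in> \<Delta>" for x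
        using T_val[OF h(1), of x x] that D by (auto simp: val_def slope_def h(2))
      then show ?thesis
        unfolding Z_def using h(1) by (auto intro!: exI[of _ "[h]"])
    qed
    ultimately show "W \<union> T \<subseteq> Z"
      by blast
    show "snd (snd p) \<in> \<rat>" if "p \<in> W \<union> T" "\<not> fst p" for p
      using that by (auto simp: W_def T_def)
    show "cadd p q \<in> Z" if pq: "p \<in> Z" "q \<in> Z" for p q
    proof -
      obtain hs hs' where "set hs \<subseteq> G" "fst p \<longrightarrow> hs \<noteq> []" "\<forall>x \<in> \<Delta>. val n x p \<le> (\<Sum>h\<leftarrow>hs. h x - g x)"
        "set hs' \<subseteq> G" "fst q \<longrightarrow> hs' \<noteq> []" "\<forall>x \<in> \<Delta>. val n x q \<le> (\<Sum>h\<leftarrow>hs'. h x - g x)"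
        using pq unfolding Z_def by blast
      then show ?thesis
        unfolding Z_def by (auto intro!: exI[of _ "hs @ hs'"] add_mono)
    qed
    show "\<nexists>x. \<forall>p \<in> W \<union> T. satisfies n x p"
    proof
      assume "\<exists>x. \<forall>p \<in> W \<union> T. satisfies n x p"
      then obtain x where x: "\<And>p. p \<in> W \<union> T \<Longrightarrow> satisfies n x p"
        by blast
      \<comment> \<open>Elimination ranges over all functions on the naturals; restricting gives a
        point of \<open>rat_space n\<close> with the same coordinates below
        \<open>n\<close>.\<close>
      define y where "y = restrict x {..<n}"
      have y: "y \<in> rat_space n" "\<And>i. i < n \<Longrightarrow> y i = x i"
        by (auto simp: y_def rat_space_def)
      have "(\<Sum>i<n. of_int (k i) * y i) + c \<le> l" if "(k, c, l) \<in> P" for k c l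
      proof -
        have "satisfies n x (False, k, of_rat (c - l))"
          using that by (intro x) (force simp: W_def)
        then have "lin n k x + of_rat (c - l) \<le> 0"
          by (simp add: satisfies_def neg_def val_def slope_def)
        then show ?thesis
          unfolding ineq using y(2) by simp
      qed
      then have "y \<in> \<Delta>"
        using y(1) P(2) by blast
      then obtain h where h: "h \<in> G" "g y \<le> h y"
        using dom by blast
      have "satisfies n x (True, \<lambda>i. K h i + - k0 i, C h - c0)"
        using h(1) by (intro x) (simp add: T_def)
      then have "lin n (\<lambda>i. K h i + - k0 i) x + (C h - c0) < 0"
        unfolding satisfies_def neg_def val_def slope_def by simp
      then show False
        using T_val[OF h(1) y] h(2) by linarith
    qed
  qed
  then obtain p hs where p: "\<forall>i<n. slope p i = 0" "\<not> neg (fst p) (snd (snd p))"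
    and hs: "set hs \<subseteq> G" "fst p \<longrightarrow> hs \<noteq> []" "\<forall>x \<in> \<Delta>. val n x p \<le> (\<Sum>h\<leftarrow>hs. h x - g x)"
    unfolding Z_def by blast
  have val_p: "val n x p = snd (snd p)" for x
    using p(1) by (simp add: val_def lin_def)
  have nonneg: "0 \<le> snd (snd p)"
    using p(2) by (auto simp: neg_def split: if_splits)
  \<comment> \<open>With an empty list \<open>p\<close> would be weak, and evaluation at a point of
    \<open>\<Delta>\<close> would make its constant at most 0, so \<open>p\<close> would not be
    contradictory.\<close>
  have "hs \<noteq> []"
  proof
    assume "hs = []"
    then have "snd (snd p) \<le> 0" "\<not> fst p"
      using hs ne val_p by auto
    then show False
      using p(2) by (simp add: neg_def)
  qed
  moreover have "of_nat (length hs) * g x \<le> (\<Sum>h\<leftarrow>hs. h x)" if "x \<in> \<Delta>" for x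
  proof -
    have "0 \<le> (\<Sum>h\<leftarrow>hs. h x - g x)"
      using hs(3) that nonneg val_p by force
    also have "\<dots> = (\<Sum>h\<leftarrow>hs. h x) - of_nat (length hs) * g x"
      by (simp add: sum_list_subtractf sum_list_triv)
    finally show ?thesis by simp
  qed
  ultimately show ?thesis
    using hs(1) by blast
qed

section \<open>The kernel of evaluation\<close>

context
  fixes n :: nat and \<Delta> :: "point set"
  assumes poly: "rational_polytope n \<Delta>" and ne: "\<Delta> \<noteq> {}" and bdd: "bounded_points n \<Delta>"
begin

interpretation preordered_group "AG n" "nonpos_on n \<Delta>"
  by (rule preordered_affine_group[OF polytope_subset[OF poly] bdd])

lemmas ev_gen = ev_ideal_gen[OF polytope_subset[OF poly]]

lemma ev_hom: "ev n \<Delta> \<in> idem_semiring_hom FI (CPA n \<Delta>)"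
proof -
  note D = polytope_subset[OF poly]
  have "ev n \<Delta> I \<in> carrier (CPA n \<Delta>)" if "I \<in> carrier FI" for I
    using that by (elim FI_cases) (auto simp: ev_gen CPA_def simp del: AG_sel)
  moreover have "ev n \<Delta> (I \<otimes>\<^bsub>FI\<^esub> J) = ev n \<Delta> I \<otimes>\<^bsub>CPA n \<Delta>\<^esub> ev n \<Delta> J"
    if IJ: "I \<in> carrier FI" "J \<in> carrier FI" for I J
  proof -
    obtain G H where G: "finite G" "G \<subseteq> carrier (AG n)" "I = gen G"
      and H: "finite H" "H \<subseteq> carrier (AG n)" "J = gen H"
      using IJ by (elim FI_cases) blast
    have "G <#>\<^bsub>AG n\<^esub> H = {} \<longleftrightarrow> G = {} \<or> H = {}"
      by (auto simp: set_mult_def)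
    then show ?thesis
      using G H D by (simp add: ev_gen gen_mult finite_set_mult set_mult_closed CPA_def max_on_set_mult del: AG_sel)
  qed
  moreover have "ev n \<Delta> (I \<oplus>\<^bsub>FI\<^esub> J) = ev n \<Delta> I \<oplus>\<^bsub>CPA n \<Delta>\<^esub> ev n \<Delta> J"
    if IJ: "I \<in> carrier FI" "J \<in> carrier FI" for I J
  proof -
    obtain G H where G: "finite G" "G \<subseteq> carrier (AG n)" "I = gen G"
      and H: "finite H" "H \<subseteq> carrier (AG n)" "J = gen H"
      using IJ by (elim FI_cases) blast
    then show ?thesis
      by (simp add: ev_gen gen_Un CPA_def max_on_Un del: AG_sel split: option.splits)
  qed
  moreover have "ev n \<Delta> \<one>\<^bsub>FI\<^esub> = \<one>\<^bsub>CPA n \<Delta>\<^esub>"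
  proof -
    have "max_on \<Delta> {\<one>\<^bsub>AG n\<^esub>} = (\<lambda>x \<in> \<Delta>. 0)"
      using D by (intro ext) (simp add: max_on_def subset_iff)
    then show ?thesis
      using ev_gen[of "{\<one>\<^bsub>AG n\<^esub>}"] by (simp add: gen_one CPA_def del: AG_sel)
  qed
  moreover have "ev n \<Delta> \<zero>\<^bsub>FI\<^esub> = \<zero>\<^bsub>CPA n \<Delta>\<^esub>"
    using ev_gen[of "{}"] by (simp add: ideal_gen_def CPA_def)
  ultimately show ?thesis
    by (auto simp: idem_semiring_hom_def ring_hom_def)
qed

lemma ev_surj: "ev n \<Delta> ` carrier FI = carrier (CPA n \<Delta>)"
proof
  show "ev n \<Delta> ` carrier FI \<subseteq> carrier (CPA n \<Delta>)"
    using ev_hom by (auto simp: idem_semiring_hom_def ring_hom_def)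
  show "carrier (CPA n \<Delta>) \<subseteq> ev n \<Delta> ` carrier FI"
  proof
    fix y assume "y \<in> carrier (CPA n \<Delta>)"
    then consider "y = None"
      | G where "finite G" "G \<noteq> {}" "G \<subseteq> carrier (AG n)" "y = Some (max_on \<Delta> G)"
      by (auto simp: CPA_def simp del: AG_sel)
    then have "\<exists>G. finite G \<and> G \<subseteq> carrier (AG n) \<and> y = ev n \<Delta> (gen G)"
    proof cases
      case 1
      then show ?thesis
        using ev_gen[of "{}"] by (intro exI[of _ "{}"]) simp
    next
      case (2 G)
      then show ?thesis
        using ev_gen[of G] by (intro exI[of _ G]) (simp del: AG_sel)
    qed
    then show "y \<in> ev n \<Delta> ` carrier FI"
      using gen_in_FI by blast
  qed
qed

text \<open>Which \<open>h\<close> dominates \<open>g\<close> may vary with the point;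
  \<open>integral_dependence\<close> turns this into a single inequality between sums, hence an
  equation of integral dependence.\<close>

lemma stably_eq_insert:
  assumes G: "finite G" "G \<subseteq> carrier (AG n)" and g: "g \<in> carrier (AG n)"
    and dom: "\<And>x. x \<in> \<Delta> \<Longrightarrow> \<exists>h \<in> G. g x \<le> h x"
  shows "FI.stably_eq (gen (insert g G)) (gen G)"
proof -
  note D = polytope_subset[OF poly]
  obtain hs where hs: "hs \<noteq> []" "set hs \<subseteq> G" "\<forall>x \<in> \<Delta>. of_nat (length hs) * g x \<le> (\<Sum>h\<leftarrow>hs. h x)"
    using integral_dependence[OF poly ne G g dom] by blast
  define a b where "a = g [^]\<^bsub>AG n\<^esub> length hs" and "b = foldr (mult (AG n)) hs (one (AG n))"
  have a: "a \<in> carrier (AG n)"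
    unfolding a_def using g by (rule nat_pow_closed)
  have b: "b \<in> carrier (AG n)"
    unfolding b_def using hs(2) G(2) by (induction hs) (auto simp del: AG_sel)
  \<comment> \<open>In additive notation \<open>q\<close> is \<open>a - b\<close>, the slack in the
    inequality for \<open>hs\<close>.\<close>
  define q where "q = inv\<^bsub>AG n\<^esub> b \<otimes>\<^bsub>AG n\<^esub> a"
  have q: "q \<in> carrier (AG n)" and abq: "a = b \<otimes>\<^bsub>AG n\<^esub> q"
    using a b by (simp_all add: q_def flip: m_assoc del: AG_sel)
  have "q x \<le> 0" if x: "x \<in> \<Delta>" for x
  proof -
    have xr: "x \<in> rat_space n"
      using x D by blast
    have "a x = b x + q x"
      using xr by (simp add: abq)
    moreover have "a x \<le> b x"
      unfolding a_def b_def foldr_affine_eval[OF xr] pow_affine_eval[OF xr] using hs(3) x by blast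
    ultimately show ?thesis by linarith
  qed
  then have "q \<in> nonpos_on n \<Delta>"
    using q by (simp add: nonpos_on_def)
  then show ?thesis
    using stably_eq_of_integral[OF G g hs(1,2)] abq unfolding a_def b_def by blast
qed

text \<open>Generators are absorbed one at a time: \<open>g\<close> is absorbed into
  \<open>gen H\<close>, the join with \<open>gen F\<close> preserves this, and the induction
  hypothesis absorbs \<open>gen F\<close>.\<close>

lemma stably_eq_dominated:
  assumes F: "finite F" and H: "finite H" "H \<subseteq> carrier (AG n)"
    and "F \<subseteq> carrier (AG n)" "\<And>g x. g \<in> F \<Longrightarrow> x \<in> \<Delta> \<Longrightarrow> \<exists>h \<in> H. g x \<le> h x"
  shows "FI.stably_eq (gen F \<union> gen H) (gen H)"
  using F assms(4,5)
proof (induction F rule: finite_induct)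
  case empty
  have "Qp \<in> bounded_elements FI" if "Qp = nonpos_on n \<Delta>" for Qp
    unfolding that bounded_iff using FI_one_closed Qp_nonempty by blast
  then show ?case
    unfolding FI.stably_eq_def by (auto simp: ideal_gen_def)
next
  case (insert g F)
  have "FI.stably_eq (gen (insert g H)) (gen H)"
    using insert.prems by (intro stably_eq_insert H) auto
  then have "FI.stably_eq (gen F \<union> gen (insert g H)) (gen F \<union> gen H)"
    using FI.stably_eq_add[of "gen (insert g H)" "gen H" "gen F"] insert.prems(1) insert.hyps(1) H
    by (simp add: gen_in_FI del: AG_sel)
  moreover have "FI.stably_eq (gen F \<union> gen H) (gen H)"
    using insert.prems by (intro insert.IH) auto
  ultimately have "FI.stably_eq (gen F \<union> gen (insert g H)) (gen H)"
    by (rule FI.stably_eq_trans) (use insert.prems(1) insert.hyps(1) H in \<open>auto intro!: gen_in_FI FI_Un_closed simp del: AG_sel\<close>)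
  then show ?case
    by (simp add: gen_Un)
qed

text \<open>Both ideals are stably equal to their union, because at each point a generator of one is
  dominated by a maximiser among the generators of the other.\<close>

lemma stably_eq_if_ev_eq:
  assumes I: "I \<in> carrier FI" and J: "J \<in> carrier FI" and eq: "ev n \<Delta> I = ev n \<Delta> J"
  shows "FI.stably_eq I J"
proof -
  have dom: "FI.stably_eq (gen G \<union> gen H) (gen H)"
    if G: "finite G" "G \<subseteq> carrier (AG n)" and H: "finite H" "H \<subseteq> carrier (AG n)"
      and eq: "ev n \<Delta> (gen G) = ev n \<Delta> (gen H)" for G H
  proof (rule stably_eq_dominated[OF G(1) H G(2)])
    fix g x assume g: "g \<in> G" and x: "x \<in> \<Delta>"
    then have HG: "H \<noteq> {}" "max_on \<Delta> G = max_on \<Delta> H"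
      using eq ev_gen[OF G] ev_gen[OF H] by (auto split: if_splits)
    have "g x \<le> max_on \<Delta> G x"
      using g x G(1) by (simp add: max_on_def)
    moreover obtain h where "h \<in> H" "max_on \<Delta> H x = h x"
      using Max_in[of "(\<lambda>h. h x) ` H"] H(1) HG(1) x unfolding image_iff by (auto simp: max_on_def simp del: Max_in)
    ultimately show "\<exists>h \<in> H. g x \<le> h x"
      unfolding HG(2) by auto
  qed
  obtain G H where G: "finite G" "G \<subseteq> carrier (AG n)" "I = gen G"
    and H: "finite H" "H \<subseteq> carrier (AG n)" "J = gen H"
    using I J by (elim FI_cases) blast
  have "FI.stably_eq (I \<union> J) J" "FI.stably_eq (I \<union> J) I"
    using dom[OF G(1,2) H(1,2)] dom[OF H(1,2) G(1,2)] eq by (simp_all add: G(3) H(3) Un_commute)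
  then show ?thesis
    using FI.stably_eq_trans[OF FI.stably_eq_sym] I J FI_Un_closed by blast
qed

text \<open>A bounded ideal is nonempty, so its value is a real function rather than minus infinity
  and cancels pointwise.\<close>

lemma ev_eq_if_stably_eq:
  assumes I: "I \<in> carrier FI" and J: "J \<in> carrier FI" and "FI.stably_eq I J"
  shows "ev n \<Delta> I = ev n \<Delta> J"
proof -
  obtain s where s: "s \<in> carrier FI" "s \<noteq> {}" and eq: "s \<otimes>\<^bsub>FI\<^esub> I = s \<otimes>\<^bsub>FI\<^esub> J"
    using assms(3) bounded_iff unfolding FI.stably_eq_def by blast
  obtain T G H where T: "finite T" "T \<subseteq> carrier (AG n)" "s = gen T"
    and G: "finite G" "G \<subseteq> carrier (AG n)" "I = gen G"
    and H: "finite H" "H \<subseteq> carrier (AG n)" "J = gen H"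
    using s(1) I J by (elim FI_cases) blast
  have "T \<noteq> {}"
    using s(2) T(3) by (auto simp: ideal_gen_def)
  have mult: "ev n \<Delta> (s \<otimes>\<^bsub>FI\<^esub> K) = ev n \<Delta> s \<otimes>\<^bsub>CPA n \<Delta>\<^esub> ev n \<Delta> K" if "K \<in> carrier FI" for K
    using ev_hom s(1) that by (simp add: idem_semiring_hom_def ring_hom_def)
  have "ev n \<Delta> s \<otimes>\<^bsub>CPA n \<Delta>\<^esub> ev n \<Delta> I = ev n \<Delta> s \<otimes>\<^bsub>CPA n \<Delta>\<^esub> ev n \<Delta> J"
    using mult[OF I] mult[OF J] eq by simp
  moreover have "max_on \<Delta> G = max_on \<Delta> H"
    if sum: "(\<lambda>x \<in> \<Delta>. max_on \<Delta> T x + max_on \<Delta> G x) = (\<lambda>x \<in> \<Delta>. max_on \<Delta> T x + max_on \<Delta> H x)"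
  proof (rule extensionalityI[of _ \<Delta>])
    show "max_on \<Delta> G x = max_on \<Delta> H x" if "x \<in> \<Delta>" for x
      using fun_cong[OF sum, of x] that by simp
  qed (simp_all add: max_on_def)
  ultimately show ?thesis
    using \<open>T \<noteq> {}\<close> T G H by (auto simp: ev_gen CPA_def simp del: AG_sel split: if_splits)
qed

lemma ev_normalisation: "semiring_normalisation TYPE('c) FI (CPA n \<Delta>) (ev n \<Delta>)"
  using stably_eq_if_ev_eq ev_eq_if_stably_eq
  by (intro semiring_normalisationI[OF FI.idem_semiring_axioms ev_hom ev_surj]) blast

end

theorem theorem5p5:
  fixes n :: nat and \<Delta> :: "point set"
  assumes "rational_polytope n \<Delta>"
    and "\<Delta> \<noteq> {}"
    and "bounded_points n \<Delta>"
  shows "semiring_normalisation TYPE('c)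
           (frac_ideals (affine_group n) (nonpos_on n \<Delta>)) (CPA n \<Delta>) (ev n \<Delta>)"
  using assms by (rule ev_normalisation)

end
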